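(* Let $M^3(c)$ be a $3$-dimensional Sasakian space form of constant holomorphic sectional curvature $c$, and let $\gamma:I\to M^3(c)$ be a polyharmonic Legendre curve parametrised by arclength. 1. If $c\le 1$, then $\gamma$ is a Legendre geodesic. 2. If $c>1$, then $\gamma$ is a Legendre geodesic or a Legendre helix of curvature $\sqrt{c-1}$.
   Context: Conventions. A contact Riemannian $3$-manifold is $(M,\eta,\xi,\varphi,g)$ with $\eta$ a contact form ($d\eta\wedge\eta\ne0$), $\xi$ its Reeb vector field ($\eta(\xi)=1$, $d\eta(\xi,\cdot)=0$), $\varphi$ an endomorphism field and $g$ a Riemannian metric such that $\varphi^2=-I+\eta\otimes\xi$, $g(\varphi X,\varphi Y)=g(X,Y)-\eta(X)\eta(Y)$, $g(\xi,\cdot)=\eta$, $d\eta(X,Y)=2g(X,\varphi Y)$, where $d\eta(X,Y)=X\eta(Y)-Y\eta(X)-\eta([X,Y])$. It is a Sasaki manifold if $(\nabla_X\varphi)Y=g(X,Y)\xi-\eta(Y)X$ for all vector fields $X,Y$ ($\nabla$ the Levi-Civita connection); then $\xi$ is Killing and $\nabla_X\xi=-\varphi X$. The holomorphic sectional curvature is the sectional curvature of $\varphi$-invariant tangent planes. A Sasakian space form is a complete connected Sasaki manifold of constant holomorphic sectional curvature $c$. With $R(X,Y)=\nabla_X\nabla_Y-\nabla_Y\nabla_X-\nabla_{[X,Y]}$, its curvature is $R(X,Y)Z=\frac{c+3}{4}\{g(Y,Z)X-g(Z,X)Y\}+\frac{c-1}{4}\{\eta(Z)\eta(X)Y-\eta(Y)\eta(Z)X+g(Z,X)\eta(Y)\xi-g(Y,Z)\eta(X)\xi-g(Y,\varphi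 Z)\varphi X-g(Z,\varphi X)\varphi Y+2g(X,\varphi Y)\varphi Z\}$. A unit-speed curve $\gamma:I\to M$ ($I$ an open interval) is a Legendre curve if $\eta(\gamma')=0$. A Frenet curve in a Riemannian $3$-manifold is a unit-speed curve with an orthonormal frame field $(\mathbf p_1=\gamma',\mathbf p_2,\mathbf p_3)$ along it and functions $\kappa,\tau\ge0$ (curvature and torsion) such that $\nabla_{\gamma'}\mathbf p_1=\kappa\mathbf p_2$, $\nabla_{\gamma'}\mathbf p_2=-\kappa\mathbf p_1+\tau\mathbf p_3$, $\nabla_{\gamma'}\mathbf p_3=-\tau\mathbf p_2$. A helix is such a curve with $\kappa$ and $\tau$ constant. A Legendre geodesic (helix) is a Legendre curve that is a geodesic (helix). A smooth map $\phi:(M,g)\to(N,h)$ of Riemannian manifolds is called polyharmonic (of order 2; also "biharmonic") if its bitension field $\mathscr T_2(\phi)=-\mathcal J_\phi(\mathscr T(\phi))$ vanishes, where $\mathscr T(\phi)=\mathrm{tr}(\nabla d\phi)$, $\mathcal J_\phi(V)=\bar\Delta_\phi V-\sum_i R^N(V,d\phi(e_i))d\phi(e_i)$ and $\bar\Delta_\phi=-\sum_i(\nabla^\phi_{e_i}\nabla^\phi_{e_i}-\nabla^\phi_{\nabla_{e_i}e_i})$ for a local orthonormal frame $(e_i)$ of the domain, $\nabla^\phi$ being the induced connection on $\phi^*TN$. For a unit-speed curve this reads $\mathscr T_2(\gamma)=\nabla_{\gamma'}\nabla_{\gamma'}\nabla_{\gamma'}\gamma'+R(\nabla_{\gamma'}\gamma',\gamma')\gamma'$.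 *)

theory Defs
  imports "HOL-Analysis.Analysis"
begin

text \<open>
  The manifold \<open>M\<close> is the whole type \<open>'m\<close>, made smooth by an atlas \<open>A\<close>.  A tensor field on \<open>M\<close> is
  given by its coordinate representations: one field on the open set \<open>coord_dom c\<close> of the model
  space for each chart \<open>c\<close>, subject to the transformation law on overlaps.
  Identities involving vector fields are required for all smooth vector fields on the domain of
  each chart.
\<close>

section \<open>Smooth maps and smooth manifolds\<close>

text \<open>The following two definitions are only meant for open \<open>S\<close>.\<close>

primrec Ck_on :: "nat \<Rightarrow> 'a::euclidean_space set \<Rightarrow> ('a \<Rightarrow> 'b::real_normed_vector) \<Rightarrow> bool" where
  "Ck_on 0 S f \<longleftrightarrow> continuous_on S f"
| "Ck_on (Suc k) S f \<longleftrightarrow>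
     (\<forall>x\<in>S. f differentiable at x) \<and> (\<forall>v. Ck_on k S (\<lambda>x. frechet_derivative f (at x) v))"

definition smooth_on :: "'a::euclidean_space set \<Rightarrow> ('a \<Rightarrow> 'b::real_normed_vector) \<Rightarrow> bool" where
  "smooth_on S f \<longleftrightarrow> (\<forall>k. Ck_on k S f)"

type_synonym ('m, 'e) chart = "'m set \<times> ('m \<Rightarrow> 'e)"

definition coord_dom :: "('m, 'e) chart \<Rightarrow> 'e set" where
  "coord_dom c = snd c ` fst c"

definition chart_inv :: "('m, 'e) chart \<Rightarrow> 'e \<Rightarrow> 'm" where
  "chart_inv c = inv_into (fst c) (snd c)"

definition overlap :: "('m, 'e) chart \<Rightarrow> ('m, 'e) chart \<Rightarrow> 'e set" where
  "overlap c d = snd c ` (fst c \<inter> fst d)"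

definition transition :: "('m, 'e) chart \<Rightarrow> ('m, 'e) chart \<Rightarrow> 'e \<Rightarrow> 'e" where
  "transition c d = snd d \<circ> chart_inv c"

abbreviation jacobian ::
    "('m, 'e::euclidean_space) chart \<Rightarrow> ('m, 'e) chart \<Rightarrow> 'e \<Rightarrow> 'e \<Rightarrow> 'e" where
  "jacobian c d q \<equiv> frechet_derivative (transition c d) (at q)"

definition smooth_atlas ::
    "('m::{t2_space,second_countable_topology}, 'e::euclidean_space) chart set \<Rightarrow> bool" where
  "smooth_atlas A \<longleftrightarrow>
     (\<forall>c\<in>A. open (fst c) \<and> open (coord_dom c) \<and>
             homeomorphism (fst c) (coord_dom c) (snd c) (chart_inv c)) \<and>
     (\<Union>c\<in>A. fst c) = UNIV \<and>
     (\<forall>c\<in>A. \<forall>d\<in>A. smooth_on (overlap c d) (transition c d))"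

section \<open>Calculus on an open subset of the model space\<close>

definition vfields :: "'e::euclidean_space set \<Rightarrow> ('e \<Rightarrow> 'e) set" where
  "vfields \<Omega> = {X. smooth_on \<Omega> X}"

definition vf_apply :: "('e::euclidean_space \<Rightarrow> 'e) \<Rightarrow> ('e \<Rightarrow> real) \<Rightarrow> 'e \<Rightarrow> real" where
  "vf_apply X f q = frechet_derivative f (at q) (X q)"

definition lie_bracket :: "('e::euclidean_space \<Rightarrow> 'e) \<Rightarrow> ('e \<Rightarrow> 'e) \<Rightarrow> 'e \<Rightarrow> 'e" where
  "lie_bracket X Y q =
     frechet_derivative Y (at q) (X q) - frechet_derivative X (at q) (Y q)"

definition ext_deriv ::
    "('e::euclidean_space \<Rightarrow> 'e \<Rightarrow> real) \<Rightarrow> ('e \<Rightarrow> 'e) \<Rightarrow> ('e \<Rightarrow> 'e) \<Rightarrow> 'e \<Rightarrow> real" where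
  "ext_deriv \<eta> X Y q =
     vf_apply X (\<lambda>q. \<eta> q (Y q)) q - vf_apply Y (\<lambda>q. \<eta> q (X q)) q - \<eta> q (lie_bracket X Y q)"

text \<open>\<open>d\<eta> \<and> \<eta>\<close> evaluated on \<open>X, Y, Z\<close>.\<close>

definition ext_deriv_wedge ::
    "('e::euclidean_space \<Rightarrow> 'e \<Rightarrow> real) \<Rightarrow> ('e \<Rightarrow> 'e) \<Rightarrow> ('e \<Rightarrow> 'e) \<Rightarrow> ('e \<Rightarrow> 'e) \<Rightarrow> 'e \<Rightarrow> real" where
  "ext_deriv_wedge \<eta> X Y Z q =
     ext_deriv \<eta> X Y q * \<eta> q (Z q) + ext_deriv \<eta> Y Z q * \<eta> q (X q)
       + ext_deriv \<eta> Z X q * \<eta> q (Y q)"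

definition metric_on :: "'e::euclidean_space set \<Rightarrow> ('e \<Rightarrow> 'e \<Rightarrow> 'e \<Rightarrow> real) \<Rightarrow> bool" where
  "metric_on \<Omega> g \<longleftrightarrow>
     (\<forall>u v. smooth_on \<Omega> (\<lambda>q. g q u v)) \<and>
     (\<forall>q\<in>\<Omega>. bilinear (g q) \<and> (\<forall>u v. g q u v = g q v u) \<and> (\<forall>v. v \<noteq> 0 \<longrightarrow> 0 < g q v v))"

text \<open>
  The Christoffel symbols, as the bilinear map \<open>\<Gamma>\<^sub>q(u, v)\<close> with components \<open>\<Gamma>\<^sup>k\<^sub>i\<^sub>j\<close>, by Koszul's
  formula for the constant vector fields \<open>u, v, w\<close> (whose Lie brackets vanish).  The lemmas
  below say that the resulting connection \<open>nabla\<close> is torsion-free and metric.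
\<close>

definition christoffel :: "('e::euclidean_space \<Rightarrow> 'e \<Rightarrow> 'e \<Rightarrow> real) \<Rightarrow> 'e \<Rightarrow> 'e \<Rightarrow> 'e \<Rightarrow> 'e" where
  "christoffel g q u v =
     (THE z. \<forall>w. 2 * g q z w =
        frechet_derivative (\<lambda>p. g p v w) (at q) u
      + frechet_derivative (\<lambda>p. g p u w) (at q) v
      - frechet_derivative (\<lambda>p. g p u v) (at q) w)"

definition nabla ::
    "('e::euclidean_space \<Rightarrow> 'e \<Rightarrow> 'e \<Rightarrow> real) \<Rightarrow> ('e \<Rightarrow> 'e) \<Rightarrow> ('e \<Rightarrow> 'e) \<Rightarrow> 'e \<Rightarrow> 'e" where
  "nabla g X Y q = frechet_derivative Y (at q) (X q) + christoffel g q (X q) (Y q)"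

text \<open>\<open>(\<nabla>\<^sub>X \<phi>) Y\<close>\<close>

definition nabla_endo ::
    "('e::euclidean_space \<Rightarrow> 'e \<Rightarrow> 'e \<Rightarrow> real) \<Rightarrow> ('e \<Rightarrow> 'e \<Rightarrow> 'e) \<Rightarrow>
     ('e \<Rightarrow> 'e) \<Rightarrow> ('e \<Rightarrow> 'e) \<Rightarrow> 'e \<Rightarrow> 'e" where
  "nabla_endo g \<phi> X Y q = nabla g X (\<lambda>q. \<phi> q (Y q)) q - \<phi> q (nabla g X Y q)"

definition curvature ::
    "('e::euclidean_space \<Rightarrow> 'e \<Rightarrow> 'e \<Rightarrow> real) \<Rightarrow>
     ('e \<Rightarrow> 'e) \<Rightarrow> ('e \<Rightarrow> 'e) \<Rightarrow> ('e \<Rightarrow> 'e) \<Rightarrow> 'e \<Rightarrow> 'e" where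
  "curvature g X Y Z q =
     nabla g X (nabla g Y Z) q - nabla g Y (nabla g X Z) q - nabla g (lie_bracket X Y) Z q"

text \<open>
  The curvature tensor on tangent vectors at \<open>q\<close>: being tensorial, it may be computed with any
  extensions of the vectors to vector fields, here the constant ones.
\<close>

definition curvature_at ::
    "('e::euclidean_space \<Rightarrow> 'e \<Rightarrow> 'e \<Rightarrow> real) \<Rightarrow> 'e \<Rightarrow> 'e \<Rightarrow> 'e \<Rightarrow> 'e \<Rightarrow> 'e" where
  "curvature_at g q u v w = curvature g (\<lambda>_. u) (\<lambda>_. v) (\<lambda>_. w) q"

definition sectional_curvature ::
    "('e::euclidean_space \<Rightarrow> 'e \<Rightarrow> 'e \<Rightarrow> real) \<Rightarrow> 'e \<Rightarrow> 'e \<Rightarrow> 'e \<Rightarrow> real" where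
  "sectional_curvature g q u v =
     g q (curvature_at g q u v v) u / (g q u u * g q v v - (g q u v)\<^sup>2)"

lemma christoffel_equation:
  assumes g: "metric_on \<Omega> g" and "open \<Omega>" and q: "q \<in> \<Omega>"
  shows "2 * g q (christoffel g q u v) w =
        frechet_derivative (\<lambda>p. g p v w) (at q) u
      + frechet_derivative (\<lambda>p. g p u w) (at q) v
      - frechet_derivative (\<lambda>p. g p u v) (at q) w"
proof -
  let ?K = "\<lambda>w. frechet_derivative (\<lambda>p. g p v w) (at q) u
      + frechet_derivative (\<lambda>p. g p u w) (at q) v
      - frechet_derivative (\<lambda>p. g p u v) (at q) w"
  have bil: "bilinear (g p)" if "p \<in> \<Omega>" for p
    using g that by (auto simp: metric_on_def)
  have pos: "0 < g q z z" if "z \<noteq> 0" for z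
    using g q that by (auto simp: metric_on_def)
  have dif: "(\<lambda>p. g p a b) differentiable at p" if "p \<in> \<Omega>" for a b p
  proof -
    have "Ck_on (Suc 0) \<Omega> (\<lambda>q. g q a b)"
      using g unfolding metric_on_def smooth_on_def by blast
    then show ?thesis using that by simp
  qed
  have ev: "frechet_derivative f (at q) = frechet_derivative h (at q)"
    if "f differentiable at q" "\<And>p. p \<in> \<Omega> \<Longrightarrow> f p = h p" for f h :: "'a \<Rightarrow> real"
    using frechet_derivative_transform_within_open[OF that(1) \<open>open \<Omega>\<close> q that(2)] .
  have lin1: "linear (\<lambda>w. frechet_derivative (\<lambda>p. g p a w) (at q) b)" for a b
  proof (rule linearI)
    fix x y :: 'a and r :: real
    have "frechet_derivative (\<lambda>p. g p a (x + y)) (at q)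
        = frechet_derivative (\<lambda>p. g p a x + g p a y) (at q)"
      by (rule ev[OF dif[OF q]]) (use bil bilinear_radd in blast)
    also have "\<dots> = (\<lambda>b. frechet_derivative (\<lambda>p. g p a x) (at q) b
                          + frechet_derivative (\<lambda>p. g p a y) (at q) b)"
      by (rule frechet_derivative_at[symmetric])
         (intro has_derivative_add frechet_derivative_works[THEN iffD1] dif q)
    finally show "frechet_derivative (\<lambda>p. g p a (x + y)) (at q) b
        = frechet_derivative (\<lambda>p. g p a x) (at q) b + frechet_derivative (\<lambda>p. g p a y) (at q) b"
      by simp
    have "frechet_derivative (\<lambda>p. g p a (r *\<^sub>R x)) (at q)
        = frechet_derivative (\<lambda>p. r *\<^sub>R g p a x) (at q)"
      by (rule ev[OF dif[OF q]]) (use bil bilinear_rmul in blast)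
    also have "\<dots> = (\<lambda>b. r *\<^sub>R frechet_derivative (\<lambda>p. g p a x) (at q) b)"
      by (rule frechet_derivative_at[symmetric])
         (intro has_derivative_scaleR_right frechet_derivative_works[THEN iffD1] dif q)
    finally show "frechet_derivative (\<lambda>p. g p a (r *\<^sub>R x)) (at q) b
        = r *\<^sub>R frechet_derivative (\<lambda>p. g p a x) (at q) b"
      by simp
  qed
  have linK: "linear ?K"
    by (intro linear_compose_add linear_compose_sub lin1 linear_frechet_derivative dif q)
  let ?G = "\<lambda>z. \<Sum>b\<in>Basis. g q z b *\<^sub>R b"
  have lin_r: "linear (g q z)" and lin_l: "linear (\<lambda>z. g q z y)" for z y
    using bil[OF q] by (auto simp: bilinear_def)
  have rep: "L w = (\<Sum>b\<in>Basis. L b *\<^sub>R b) \<bullet> w" if "linear L" for L :: "'a \<Rightarrow> real" and w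
  proof -
    have "L w = L (\<Sum>b\<in>Basis. (w \<bullet> b) *\<^sub>R b)" by (simp add: euclidean_representation)
    also have "\<dots> = (\<Sum>b\<in>Basis. (w \<bullet> b) * L b)"
      by (simp add: linear_sum[OF that] linear_scale[OF that])
    also have "\<dots> = (\<Sum>b\<in>Basis. L b *\<^sub>R b) \<bullet> w"
      by (simp only: inner_sum_left inner_scaleR_left) (intro sum.cong refl, metis inner_commute mult.commute)
    finally show ?thesis .
  qed
  have linG: "linear ?G"
    by (intro linear_compose_sum ballI linearI)
       (simp_all add: linear_add[OF lin_l] linear_scale[OF lin_l] scaleR_add_left)
  have "inj ?G"
    unfolding linear_injective_0[OF linG]
  proof (intro allI impI)
    fix z assume "?G z = 0"
    then have "g q z z = 0" using rep[OF lin_r, of z z] by simp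
    then show "z = 0" using pos by (metis less_irrefl)
  qed
  then have "surj ?G" using linG linear_injective_imp_surjective by blast
  from surjD[OF this, of "\<Sum>b\<in>Basis. (?K b / 2) *\<^sub>R b"]
  obtain z where z: "(\<Sum>b\<in>Basis. (?K b / 2) *\<^sub>R b) = ?G z" ..
  have linK2: "linear (\<lambda>w. ?K w / 2)"
    using linear_compose_scale_right[OF linK, of "1/2"] by (simp add: field_simps)
  have half: "2 * x = y" if "x = y / 2" for x y :: real using that by simp
  have ex: "\<forall>w. 2 * g q z w = ?K w"
  proof
    fix w
    have "g q z w = ?K w / 2"
      by (subst rep[OF lin_r], subst rep[OF linK2], subst z) (rule refl)
    then show "2 * g q z w = ?K w" by (rule half)
  qed
  have "\<forall>w. 2 * g q (christoffel g q u v) w = ?K w"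
    unfolding christoffel_def
  proof (rule theI[where a = z and P = "\<lambda>z. \<forall>w. 2 * g q z w = ?K w"])
    show "\<forall>w. 2 * g q z w = ?K w" by (rule ex)
    fix z' assume z': "\<forall>w. 2 * g q z' w = ?K w"
    then have "g q z' w = g q z w" for w using ex by (metis mult_cancel_left zero_neq_numeral)
    then have "g q (z' - z) (z' - z) = 0" by (simp add: linear_diff[OF lin_l])
    then show "z' = z" using pos by (metis less_irrefl right_minus_eq)
  qed
  then show ?thesis by blast
qed

lemma frechet_derivative_metric_sym:
  assumes g: "metric_on \<Omega> g" and "open \<Omega>" and q: "q \<in> \<Omega>"
  shows "frechet_derivative (\<lambda>p. g p u v) (at q) = frechet_derivative (\<lambda>p. g p v u) (at q)"
proof (rule frechet_derivative_transform_within_open[OF _ \<open>open \<Omega>\<close> q])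
  have "Ck_on (Suc 0) \<Omega> (\<lambda>q. g q u v)"
    using g unfolding metric_on_def smooth_on_def by blast
  then show "(\<lambda>p. g p u v) differentiable at q" using q by simp
qed (use g in \<open>auto simp: metric_on_def\<close>)

lemma nabla_torsion_free:
  assumes "metric_on \<Omega> g" and "open \<Omega>" and "q \<in> \<Omega>"
  shows "nabla g X Y q - nabla g Y X q = lie_bracket X Y q"
proof -
  have "christoffel g q u v = christoffel g q v u" for u v
    unfolding christoffel_def frechet_derivative_metric_sym[OF assms, of u v]
    by (simp add: add.commute)
  then show ?thesis by (simp add: nabla_def lie_bracket_def)
qed

text \<open>\<open>nabla g X (\<lambda>_. v) q = christoffel g q (X q) v\<close>, so this is metric compatibility on a frame of
  constant vector fields.\<close>

lemma nabla_metric: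
  assumes g: "metric_on \<Omega> g" and "open \<Omega>" and q: "q \<in> \<Omega>"
  shows "vf_apply X (\<lambda>p. g p v w) q
       = g q (nabla g X (\<lambda>_. v) q) w + g q v (nabla g X (\<lambda>_. w) q)"
proof -
  have sym: "g q a b = g q b a" for a b using g q by (auto simp: metric_on_def)
  show ?thesis
    using christoffel_equation[OF assms, of "X q" v w] christoffel_equation[OF assms, of "X q" w v]
    by (simp add: nabla_def vf_apply_def sym[of v] frechet_derivative_metric_sym[OF assms, of w v])
qed

section \<open>Tensor fields on a manifold\<close>

definition vector_field ::
    "('m, 'e::euclidean_space) chart set \<Rightarrow> (('m, 'e) chart \<Rightarrow> 'e \<Rightarrow> 'e) \<Rightarrow> bool" where
  "vector_field A X \<longleftrightarrow>
     (\<forall>c\<in>A. X c \<in> vfields (coord_dom c)) \<and>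
     (\<forall>c\<in>A. \<forall>d\<in>A. \<forall>q\<in>overlap c d. X d (transition c d q) = jacobian c d q (X c q))"

definition one_form ::
    "('m, 'e::euclidean_space) chart set \<Rightarrow> (('m, 'e) chart \<Rightarrow> 'e \<Rightarrow> 'e \<Rightarrow> real) \<Rightarrow> bool" where
  "one_form A \<eta> \<longleftrightarrow>
     (\<forall>c\<in>A. (\<forall>v. smooth_on (coord_dom c) (\<lambda>q. \<eta> c q v)) \<and> (\<forall>q\<in>coord_dom c. linear (\<eta> c q))) \<and>
     (\<forall>c\<in>A. \<forall>d\<in>A. \<forall>q\<in>overlap c d. \<forall>v. \<eta> d (transition c d q) (jacobian c d q v) = \<eta> c q v)"

definition endomorphism_field ::
    "('m, 'e::euclidean_space) chart set \<Rightarrow> (('m, 'e) chart \<Rightarrow> 'e \<Rightarrow> 'e \<Rightarrow> 'e) \<Rightarrow> bool" where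
  "endomorphism_field A \<phi> \<longleftrightarrow>
     (\<forall>c\<in>A. (\<forall>v. smooth_on (coord_dom c) (\<lambda>q. \<phi> c q v)) \<and> (\<forall>q\<in>coord_dom c. linear (\<phi> c q))) \<and>
     (\<forall>c\<in>A. \<forall>d\<in>A. \<forall>q\<in>overlap c d. \<forall>v.
        \<phi> d (transition c d q) (jacobian c d q v) = jacobian c d q (\<phi> c q v))"

definition riemannian_metric ::
    "('m, 'e::euclidean_space) chart set \<Rightarrow> (('m, 'e) chart \<Rightarrow> 'e \<Rightarrow> 'e \<Rightarrow> 'e \<Rightarrow> real) \<Rightarrow> bool" where
  "riemannian_metric A g \<longleftrightarrow>
     (\<forall>c\<in>A. metric_on (coord_dom c) (g c)) \<and>
     (\<forall>c\<in>A. \<forall>d\<in>A. \<forall>q\<in>overlap c d. \<forall>u v.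
        g d (transition c d q) (jacobian c d q u) (jacobian c d q v) = g c q u v)"

section \<open>Curves\<close>

definition open_interval :: "real set \<Rightarrow> bool" where
  "open_interval I \<longleftrightarrow> open I \<and> is_interval I \<and> I \<noteq> {}"

definition curve_dom :: "real set \<Rightarrow> (real \<Rightarrow> 'm) \<Rightarrow> ('m, 'e) chart \<Rightarrow> real set" where
  "curve_dom I \<gamma> c = {t\<in>I. \<gamma> t \<in> fst c}"

definition smooth_curve ::
    "('m::topological_space, 'e::euclidean_space) chart set \<Rightarrow> real set \<Rightarrow> (real \<Rightarrow> 'm) \<Rightarrow> bool" where
  "smooth_curve A I \<gamma> \<longleftrightarrow>
     continuous_on I \<gamma> \<and> (\<forall>c\<in>A. smooth_on (curve_dom I \<gamma> c) (\<lambda>t. snd c (\<gamma> t)))"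

text \<open>
  Vector fields along \<open>\<gamma>\<close> are likewise given by their components \<open>V c t\<close> in every chart, which are
  meaningful for \<open>t \<in> curve_dom I \<gamma> c\<close> only.
\<close>

definition vector_field_along ::
    "('m, 'e::euclidean_space) chart set \<Rightarrow> real set \<Rightarrow> (real \<Rightarrow> 'm) \<Rightarrow>
     (('m, 'e) chart \<Rightarrow> real \<Rightarrow> 'e) \<Rightarrow> bool" where
  "vector_field_along A I \<gamma> V \<longleftrightarrow>
     (\<forall>c\<in>A. smooth_on (curve_dom I \<gamma> c) (V c)) \<and>
     (\<forall>c\<in>A. \<forall>d\<in>A. \<forall>t\<in>curve_dom I \<gamma> c \<inter> curve_dom I \<gamma> d.
        V d t = jacobian c d (snd c (\<gamma> t)) (V c t))"

definition velocity :: "(real \<Rightarrow> 'm) \<Rightarrow> ('m, 'e::euclidean_space) chart \<Rightarrow> real \<Rightarrow> 'e" where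
  "velocity \<gamma> c t = vector_derivative (\<lambda>s. snd c (\<gamma> s)) (at t)"

text \<open>\<open>\<nabla>\<^sub>\<gamma>\<^sub>' V\<close>\<close>

definition cov_along ::
    "(('m, 'e::euclidean_space) chart \<Rightarrow> 'e \<Rightarrow> 'e \<Rightarrow> 'e \<Rightarrow> real) \<Rightarrow> (real \<Rightarrow> 'm) \<Rightarrow>
     (('m, 'e) chart \<Rightarrow> real \<Rightarrow> 'e) \<Rightarrow> ('m, 'e) chart \<Rightarrow> real \<Rightarrow> 'e" where
  "cov_along g \<gamma> V c t =
     vector_derivative (V c) (at t) + christoffel (g c) (snd c (\<gamma> t)) (velocity \<gamma> c t) (V c t)"

definition geodesic ::
    "('m::topological_space, 'e::euclidean_space) chart set \<Rightarrow>
     (('m, 'e) chart \<Rightarrow> 'e \<Rightarrow> 'e \<Rightarrow> 'e \<Rightarrow> real) \<Rightarrow> real set \<Rightarrow> (real \<Rightarrow> 'm) \<Rightarrow> bool" where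
  "geodesic A g I \<gamma> \<longleftrightarrow>
     smooth_curve A I \<gamma> \<and> (\<forall>c\<in>A. \<forall>t\<in>curve_dom I \<gamma> c. cov_along g \<gamma> (velocity \<gamma>) c t = 0)"

definition geodesically_complete ::
    "('m::topological_space, 'e::euclidean_space) chart set \<Rightarrow>
     (('m, 'e) chart \<Rightarrow> 'e \<Rightarrow> 'e \<Rightarrow> 'e \<Rightarrow> real) \<Rightarrow> bool" where
  "geodesically_complete A g \<longleftrightarrow>
     (\<forall>c\<in>A. \<forall>p\<in>fst c. \<forall>v. \<exists>\<gamma>. geodesic A g UNIV \<gamma> \<and> \<gamma> 0 = p \<and> velocity \<gamma> c 0 = v)"

definition unit_speed_curve ::
    "('m::topological_space, 'e::euclidean_space) chart set \<Rightarrow>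
     (('m, 'e) chart \<Rightarrow> 'e \<Rightarrow> 'e \<Rightarrow> 'e \<Rightarrow> real) \<Rightarrow> real set \<Rightarrow> (real \<Rightarrow> 'm) \<Rightarrow> bool" where
  "unit_speed_curve A g I \<gamma> \<longleftrightarrow>
     smooth_curve A I \<gamma> \<and>
     (\<forall>c\<in>A. \<forall>t\<in>curve_dom I \<gamma> c. g c (snd c (\<gamma> t)) (velocity \<gamma> c t) (velocity \<gamma> c t) = 1)"

text \<open>
  The bitension field of \<open>\<gamma>\<close>, regarded as a map from \<open>(I, dt\<^sup>2)\<close>: the orthonormal frame of the
  domain is \<open>d/dt\<close>, which is parallel.
\<close>

definition tension ::
    "(('m, 'e::euclidean_space) chart \<Rightarrow> 'e \<Rightarrow> 'e \<Rightarrow> 'e \<Rightarrow> real) \<Rightarrow> (real \<Rightarrow> 'm) \<Rightarrow>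
     ('m, 'e) chart \<Rightarrow> real \<Rightarrow> 'e" where
  "tension g \<gamma> = cov_along g \<gamma> (velocity \<gamma>)"

definition rough_laplacian ::
    "(('m, 'e::euclidean_space) chart \<Rightarrow> 'e \<Rightarrow> 'e \<Rightarrow> 'e \<Rightarrow> real) \<Rightarrow> (real \<Rightarrow> 'm) \<Rightarrow>
     (('m, 'e) chart \<Rightarrow> real \<Rightarrow> 'e) \<Rightarrow> ('m, 'e) chart \<Rightarrow> real \<Rightarrow> 'e" where
  "rough_laplacian g \<gamma> V c t = - cov_along g \<gamma> (cov_along g \<gamma> V) c t"

definition jacobi_operator ::
    "(('m, 'e::euclidean_space) chart \<Rightarrow> 'e \<Rightarrow> 'e \<Rightarrow> 'e \<Rightarrow> real) \<Rightarrow> (real \<Rightarrow> 'm) \<Rightarrow>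
     (('m, 'e) chart \<Rightarrow> real \<Rightarrow> 'e) \<Rightarrow> ('m, 'e) chart \<Rightarrow> real \<Rightarrow> 'e" where
  "jacobi_operator g \<gamma> V c t =
     rough_laplacian g \<gamma> V c t
       - curvature_at (g c) (snd c (\<gamma> t)) (V c t) (velocity \<gamma> c t) (velocity \<gamma> c t)"

definition bitension ::
    "(('m, 'e::euclidean_space) chart \<Rightarrow> 'e \<Rightarrow> 'e \<Rightarrow> 'e \<Rightarrow> real) \<Rightarrow> (real \<Rightarrow> 'm) \<Rightarrow>
     ('m, 'e) chart \<Rightarrow> real \<Rightarrow> 'e" where
  "bitension g \<gamma> c t = - jacobi_operator g \<gamma> (tension g \<gamma>) c t"

definition polyharmonic_curve ::
    "('m::topological_space, 'e::euclidean_space) chart set \<Rightarrow>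
     (('m, 'e) chart \<Rightarrow> 'e \<Rightarrow> 'e \<Rightarrow> 'e \<Rightarrow> real) \<Rightarrow> real set \<Rightarrow> (real \<Rightarrow> 'm) \<Rightarrow> bool" where
  "polyharmonic_curve A g I \<gamma> \<longleftrightarrow>
     smooth_curve A I \<gamma> \<and> (\<forall>c\<in>A. \<forall>t\<in>curve_dom I \<gamma> c. bitension g \<gamma> c t = 0)"

definition frenet_curve ::
    "('m::topological_space, real^3) chart set \<Rightarrow>
     (('m, real^3) chart \<Rightarrow> real^3 \<Rightarrow> real^3 \<Rightarrow> real^3 \<Rightarrow> real) \<Rightarrow> real set \<Rightarrow> (real \<Rightarrow> 'm) \<Rightarrow>
     (('m, real^3) chart \<Rightarrow> real \<Rightarrow> real^3) \<Rightarrow> (('m, real^3) chart \<Rightarrow> real \<Rightarrow> real^3) \<Rightarrow>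
     (real \<Rightarrow> real) \<Rightarrow> (real \<Rightarrow> real) \<Rightarrow> bool" where
  "frenet_curve A g I \<gamma> p2 p3 \<kappa> \<tau> \<longleftrightarrow>
     unit_speed_curve A g I \<gamma> \<and> vector_field_along A I \<gamma> p2 \<and> vector_field_along A I \<gamma> p3 \<and>
     (\<forall>t\<in>I. 0 \<le> \<kappa> t \<and> 0 \<le> \<tau> t) \<and>
     (\<forall>c\<in>A. \<forall>t\<in>curve_dom I \<gamma> c.
        let G = g c (snd c (\<gamma> t)); p1 = velocity \<gamma> in
          G (p2 c t) (p2 c t) = 1 \<and> G (p3 c t) (p3 c t) = 1 \<and>
          G (p1 c t) (p2 c t) = 0 \<and> G (p1 c t) (p3 c t) = 0 \<and> G (p2 c t) (p3 c t) = 0 \<and>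
          cov_along g \<gamma> p1 c t = \<kappa> t *\<^sub>R p2 c t \<and>
          cov_along g \<gamma> p2 c t = - \<kappa> t *\<^sub>R p1 c t + \<tau> t *\<^sub>R p3 c t \<and>
          cov_along g \<gamma> p3 c t = - \<tau> t *\<^sub>R p2 c t)"

definition helix_of_curvature ::
    "('m::topological_space, real^3) chart set \<Rightarrow>
     (('m, real^3) chart \<Rightarrow> real^3 \<Rightarrow> real^3 \<Rightarrow> real^3 \<Rightarrow> real) \<Rightarrow> real set \<Rightarrow> (real \<Rightarrow> 'm) \<Rightarrow>
     real \<Rightarrow> bool" where
  "helix_of_curvature A g I \<gamma> k \<longleftrightarrow>
     (\<exists>p2 p3 \<kappa> \<tau>. frenet_curve A g I \<gamma> p2 p3 \<kappa> \<tau> \<and>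
        (\<forall>t\<in>I. \<kappa> t = k) \<and> (\<exists>s. \<forall>t\<in>I. \<tau> t = s))"

section \<open>Contact Riemannian 3-manifolds and Sasakian space forms\<close>

definition contact_riemannian ::
    "('m::{t2_space,second_countable_topology}, real^3) chart set \<Rightarrow>
     (('m, real^3) chart \<Rightarrow> real^3 \<Rightarrow> real^3 \<Rightarrow> real) \<Rightarrow>
     (('m, real^3) chart \<Rightarrow> real^3 \<Rightarrow> real^3) \<Rightarrow>
     (('m, real^3) chart \<Rightarrow> real^3 \<Rightarrow> real^3 \<Rightarrow> real^3) \<Rightarrow>
     (('m, real^3) chart \<Rightarrow> real^3 \<Rightarrow> real^3 \<Rightarrow> real^3 \<Rightarrow> real) \<Rightarrow> bool" where
  "contact_riemannian A \<eta> \<xi> \<phi> g \<longleftrightarrow>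
     smooth_atlas A \<and> one_form A \<eta> \<and> vector_field A \<xi> \<and> endomorphism_field A \<phi> \<and>
     riemannian_metric A g \<and>
     (\<forall>c\<in>A. \<forall>q\<in>coord_dom c.
        (\<exists>X\<in>vfields (coord_dom c). \<exists>Y\<in>vfields (coord_dom c). \<exists>Z\<in>vfields (coord_dom c).
           ext_deriv_wedge (\<eta> c) X Y Z q \<noteq> 0) \<and>
        \<eta> c q (\<xi> c q) = 1 \<and>
        (\<forall>X\<in>vfields (coord_dom c). ext_deriv (\<eta> c) (\<xi> c) X q = 0) \<and>
        (\<forall>u. \<phi> c q (\<phi> c q u) = - u + \<eta> c q u *\<^sub>R \<xi> c q) \<and>
        (\<forall>u v. g c q (\<phi> c q u) (\<phi> c q v) = g c q u v - \<eta> c q u * \<eta> c q v) \<and>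
        (\<forall>u. g c q (\<xi> c q) u = \<eta> c q u) \<and>
        (\<forall>X\<in>vfields (coord_dom c). \<forall>Y\<in>vfields (coord_dom c).
           ext_deriv (\<eta> c) X Y q = 2 * g c q (X q) (\<phi> c q (Y q))))"

definition sasaki ::
    "('m::{t2_space,second_countable_topology}, real^3) chart set \<Rightarrow>
     (('m, real^3) chart \<Rightarrow> real^3 \<Rightarrow> real^3 \<Rightarrow> real) \<Rightarrow>
     (('m, real^3) chart \<Rightarrow> real^3 \<Rightarrow> real^3) \<Rightarrow>
     (('m, real^3) chart \<Rightarrow> real^3 \<Rightarrow> real^3 \<Rightarrow> real^3) \<Rightarrow>
     (('m, real^3) chart \<Rightarrow> real^3 \<Rightarrow> real^3 \<Rightarrow> real^3 \<Rightarrow> real) \<Rightarrow> bool" where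
  "sasaki A \<eta> \<xi> \<phi> g \<longleftrightarrow>
     contact_riemannian A \<eta> \<xi> \<phi> g \<and>
     (\<forall>c\<in>A. \<forall>X\<in>vfields (coord_dom c). \<forall>Y\<in>vfields (coord_dom c). \<forall>q\<in>coord_dom c.
        nabla_endo (g c) (\<phi> c) X Y q = g c q (X q) (Y q) *\<^sub>R \<xi> c q - \<eta> c q (Y q) *\<^sub>R X q)"

definition constant_holomorphic_curvature ::
    "('m, real^3) chart set \<Rightarrow>
     (('m, real^3) chart \<Rightarrow> real^3 \<Rightarrow> real^3 \<Rightarrow> real^3) \<Rightarrow>
     (('m, real^3) chart \<Rightarrow> real^3 \<Rightarrow> real^3 \<Rightarrow> real^3 \<Rightarrow> real) \<Rightarrow> real \<Rightarrow> bool" where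
  "constant_holomorphic_curvature A \<phi> g k \<longleftrightarrow>
     (\<forall>c\<in>A. \<forall>q\<in>coord_dom c. \<forall>u v.
        dim (span {u, v}) = 2 \<and> \<phi> c q ` span {u, v} \<subseteq> span {u, v} \<longrightarrow>
        sectional_curvature (g c) q u v = k)"

definition sasakian_space_form ::
    "('m::{t2_space,second_countable_topology}, real^3) chart set \<Rightarrow>
     (('m, real^3) chart \<Rightarrow> real^3 \<Rightarrow> real^3 \<Rightarrow> real) \<Rightarrow>
     (('m, real^3) chart \<Rightarrow> real^3 \<Rightarrow> real^3) \<Rightarrow>
     (('m, real^3) chart \<Rightarrow> real^3 \<Rightarrow> real^3 \<Rightarrow> real^3) \<Rightarrow>
     (('m, real^3) chart \<Rightarrow> real^3 \<Rightarrow> real^3 \<Rightarrow> real^3 \<Rightarrow> real) \<Rightarrow> real \<Rightarrow> bool" where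
  "sasakian_space_form A \<eta> \<xi> \<phi> g k \<longleftrightarrow>
     sasaki A \<eta> \<xi> \<phi> g \<and> connected (UNIV :: 'm set) \<and> geodesically_complete A g \<and>
     constant_holomorphic_curvature A \<phi> g k"

definition legendre_curve ::
    "('m::topological_space, real^3) chart set \<Rightarrow>
     (('m, real^3) chart \<Rightarrow> real^3 \<Rightarrow> real^3 \<Rightarrow> real) \<Rightarrow>
     (('m, real^3) chart \<Rightarrow> real^3 \<Rightarrow> real^3 \<Rightarrow> real^3 \<Rightarrow> real) \<Rightarrow> real set \<Rightarrow> (real \<Rightarrow> 'm) \<Rightarrow> bool" where
  "legendre_curve A \<eta> g I \<gamma> \<longleftrightarrow>
     unit_speed_curve A g I \<gamma> \<and>
     (\<forall>c\<in>A. \<forall>t\<in>curve_dom I \<gamma> c. \<eta> c (snd c (\<gamma> t)) (velocity \<gamma> c t) = 0)"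

definition legendre_geodesic ::
    "('m::topological_space, real^3) chart set \<Rightarrow>
     (('m, real^3) chart \<Rightarrow> real^3 \<Rightarrow> real^3 \<Rightarrow> real) \<Rightarrow>
     (('m, real^3) chart \<Rightarrow> real^3 \<Rightarrow> real^3 \<Rightarrow> real^3 \<Rightarrow> real) \<Rightarrow> real set \<Rightarrow> (real \<Rightarrow> 'm) \<Rightarrow> bool" where
  "legendre_geodesic A \<eta> g I \<gamma> \<longleftrightarrow> legendre_curve A \<eta> g I \<gamma> \<and> geodesic A g I \<gamma>"

definition legendre_helix_of_curvature ::
    "('m::topological_space, real^3) chart set \<Rightarrow>
     (('m, real^3) chart \<Rightarrow> real^3 \<Rightarrow> real^3 \<Rightarrow> real) \<Rightarrow>
     (('m, real^3) chart \<Rightarrow> real^3 \<Rightarrow> real^3 \<Rightarrow> real^3 \<Rightarrow> real) \<Rightarrow> real set \<Rightarrow> (real \<Rightarrow> 'm) \<Rightarrow>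
     real \<Rightarrow> bool" where
  "legendre_helix_of_curvature A \<eta> g I \<gamma> k \<longleftrightarrow>
     legendre_curve A \<eta> g I \<gamma> \<and> helix_of_curvature A g I \<gamma> k"

end

theory Submission
  imports Defs
begin

text \<open>
  Along a Legendre curve with unit tangent \<open>T\<close>, the fields \<open>T\<close>, \<open>N = \<phi>T\<close>, \<open>\<xi>\<close> form an orthonormal frame
  with \<open>\<nabla>\<^sub>T T = \<kappa>N\<close>, \<open>\<nabla>\<^sub>T N = -\<kappa>T + \<xi>\<close>, \<open>\<nabla>\<^sub>T \<xi> = -N\<close>, where \<open>\<kappa>\<close> is a signed curvature.  Since
  \<open>g(R(N,T)T, T) = 0\<close> and \<open>g(R(N,T)T, N) = c\<close>, the \<open>T\<close>- and \<open>N\<close>-components of the vanishing bitension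
  field are \<open>-3\<kappa>\<kappa>' = 0\<close> and \<open>\<kappa>'' - \<kappa>\<^sup>3 - \<kappa> + c\<kappa> = 0\<close>; the full formula for the curvature tensor is not
  needed.  Hence \<open>\<kappa>\<close> is constant, and either \<open>\<kappa> = 0\<close> or \<open>\<kappa>\<^sup>2 = c - 1\<close>.  The sign of \<open>\<kappa>\<close> is
  independent of the chart because the covariant derivative along the curve is.
\<close>


section \<open>Maps of class \<open>C\<^sup>k\<close>\<close>

text \<open>The equation \<kappa>\<kappa>' = 0 says nothing about \<kappa>' at a zero of \<kappa>;
  what it makes constant is \<kappa>^2, and once that constant is nonzero, \<kappa> has no zeros.
  This argument runs along the whole interval, whereas all fields are given chart by chart and the
  parameters at which a curve visits one chart need not form an interval. Hence the need for a
  chart-independent \<kappa>, and with it for the transformation law of the Christoffel symbols.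
  These symbols are given by a definite description, so their linearity and smoothness have to be
  extracted from Koszul's formula before the frame can be differentiated repeatedly. The value
  g(R(N,T)T, N) = c is the sectional curvature of the plane of T and \<phi>T. The number c - 1 is c
  minus the square of the torsion: the coefficient 1 of \<xi> in the derivative of N, together with
  the coefficient -1 in the derivative of \<xi>, produces the term -\<kappa>, so that a constant
  \<kappa> other than 0 satisfies \<kappa>^2 + 1 = c.\<close>

lemma Ck_on_cong:
  assumes S: "open S"
  shows "Ck_on k S f \<Longrightarrow> (\<And>x. x \<in> S \<Longrightarrow> f x = h x) \<Longrightarrow> Ck_on k S h"
proof (induction k arbitrary: f h)
  case 0
  then show ?case using continuous_on_cong[OF refl, of S f h] by simp
next
  case (Suc k)
  have eq: "frechet_derivative f (at x) = frechet_derivative h (at x)" if "x \<in> S" for x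
    by (rule frechet_derivative_transform_within_open[OF _ S that]) (use Suc.prems that in auto)
  have d: "h differentiable at x" if "x \<in> S" for x
  proof -
    have "(f has_derivative frechet_derivative f (at x)) (at x)"
      using Suc.prems(1) that by (simp add: frechet_derivative_works)
    then show ?thesis
      by (rule differentiableI[OF has_derivative_transform_within_open[OF _ S that]])
        (use Suc.prems(2) in auto)
  qed
  have "Ck_on k S (\<lambda>x. frechet_derivative h (at x) v)" for v
    by (rule Suc.IH[of "\<lambda>x. frechet_derivative f (at x) v"]) (use Suc.prems eq in auto)
  then show ?case using d by simp
qed

text \<open>Uniqueness of the derivative allows any explicit formula for it in place of
  \<open>frechet_derivative\<close>. Closure of the class under an operation then follows by
  induction from the differentiation rule of that operation.\<close>

lemma Ck_on_SucI:
  assumes S: "open S"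
    and f': "\<And>x. x \<in> S \<Longrightarrow> (f has_derivative f' x) (at x)"
    and Ck: "\<And>v. Ck_on k S (\<lambda>x. f' x v)"
  shows "Ck_on (Suc k) S f"
proof -
  have "f' x = frechet_derivative f (at x)" if "x \<in> S" for x
    by (rule frechet_derivative_at[OF f'[OF that]])
  then have "Ck_on k S (\<lambda>x. frechet_derivative f (at x) v)" for v
    by (intro Ck_on_cong[OF S Ck[of v]]) simp
  then show ?thesis using f' by (auto simp: differentiable_def)
qed

lemma Ck_on_SucE:
  assumes "Ck_on (Suc k) S f" and "x \<in> S"
  shows "(f has_derivative frechet_derivative f (at x)) (at x)"
  using assms by (simp add: frechet_derivative_works)

lemma Ck_on_Suc_continuous_on: "Ck_on (Suc k) S f \<Longrightarrow> continuous_on S f"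
  by (intro differentiable_imp_continuous_on differentiable_at_imp_differentiable_on) simp

text \<open>The product rule pairs a derivative with an undifferentiated factor; this brings the
  latter down to the class of the induction hypothesis.\<close>

lemma Ck_on_SucD: "Ck_on (Suc k) S f \<Longrightarrow> Ck_on k S f"
proof (induction k arbitrary: f)
  case 0
  then show ?case by (simp only: Ck_on.simps(1) Ck_on_Suc_continuous_on)
next
  case (Suc k)
  then show ?case by (subst Ck_on.simps(2)) (metis Ck_on.simps(2))
qed

lemma Ck_on_const: "open S \<Longrightarrow> Ck_on k S (\<lambda>x. a)"
proof (induction k arbitrary: a)
  case (Suc k)
  then show ?case by (intro Ck_on_SucI[where f' = "\<lambda>x v. 0"]) auto
qed simp

lemma Ck_on_add:
  assumes "open S"
  shows "Ck_on k S f \<Longrightarrow> Ck_on k S h \<Longrightarrow> Ck_on k S (\<lambda>x. f x + h x)"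
proof (induction k arbitrary: f h)
  case 0
  then show ?case by (auto intro: continuous_intros)
next
  case (Suc k)
  show ?case
    by (rule Ck_on_SucI[OF assms, OF has_derivative_add[OF Ck_on_SucE Ck_on_SucE]])
       (use Suc in auto)
qed

lemma (in bounded_bilinear) Ck_on:
  assumes "open S"
  shows "Ck_on k S f \<Longrightarrow> Ck_on k S h \<Longrightarrow> Ck_on k S (\<lambda>x. prod (f x) (h x))"
proof (induction k arbitrary: f h)
  case 0
  then show ?case by (auto intro: continuous_on)
next
  case (Suc k)
  show ?case
    by (rule Ck_on_SucI[OF assms, OF FDERIV[OF Ck_on_SucE Ck_on_SucE]])
       (use Suc Ck_on_SucD[OF Suc.prems(1)] Ck_on_SucD[OF Suc.prems(2)] in
         \<open>auto intro!: Ck_on_add[OF assms]\<close>)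
qed

lemma (in bounded_linear) Ck_on:
  assumes "open S"
  shows "Ck_on k S h \<Longrightarrow> Ck_on k S (\<lambda>x. f (h x))"
proof (induction k arbitrary: h)
  case 0
  then show ?case by (auto intro: continuous_on)
next
  case (Suc k)
  show ?case
    by (rule Ck_on_SucI[OF assms, OF has_derivative[OF Ck_on_SucE]]) (use Suc in auto)
qed

lemma Ck_on_sum:
  assumes "open S"
  shows "(\<And>i. i \<in> N \<Longrightarrow> Ck_on k S (f i)) \<Longrightarrow> Ck_on k S (\<lambda>x. \<Sum>i\<in>N. f i x)"
  by (induction N rule: infinite_finite_induct) (auto intro: Ck_on_const Ck_on_add assms)

lemma Ck_on_prod:
  fixes f :: "'i \<Rightarrow> 'a::euclidean_space \<Rightarrow> real"
  assumes "open S"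
  shows "(\<And>i. i \<in> N \<Longrightarrow> Ck_on k S (f i)) \<Longrightarrow> Ck_on k S (\<lambda>x. \<Prod>i\<in>N. f i x)"
  by (induction N rule: infinite_finite_induct)
     (auto intro: Ck_on_const bounded_bilinear.Ck_on[OF bounded_bilinear_mult] assms)

lemma Ck_on_inverse:
  fixes f :: "'a::euclidean_space \<Rightarrow> real"
  assumes "open S" and nz: "\<And>x. x \<in> S \<Longrightarrow> f x \<noteq> 0"
  shows "Ck_on k S f \<Longrightarrow> Ck_on k S (\<lambda>x. inverse (f x))"
proof (induction k)
  case 0
  then show ?case using nz by (auto intro: continuous_intros)
next
  case (Suc k)
  show ?case
  proof (rule Ck_on_SucI[OF assms(1)])
    \<comment> \<open>The derivative is written in terms of \<open>inverse (f x)\<close> itself, so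
      that the induction hypothesis applies to it.\<close>
    show "((\<lambda>x. inverse (f x)) has_derivative
        (\<lambda>v. (-1) * (inverse (f x) * (frechet_derivative f (at x) v * inverse (f x))))) (at x)"
      if "x \<in> S" for x
      using Deriv.has_derivative_inverse[OF nz[OF that] Ck_on_SucE[OF Suc.prems that]]
      by (simp add: mult.assoc)
    show "Ck_on k S (\<lambda>x. (-1) * (inverse (f x) * (frechet_derivative f (at x) v * inverse (f x))))" for v
      using Suc Ck_on_SucD[OF Suc.prems]
      by (intro bounded_bilinear.Ck_on[OF bounded_bilinear_mult] Ck_on_const assms(1)) auto
  qed
qed

lemma linear_eq_sum_Basis:
  assumes "linear f"
  shows "f v = (\<Sum>b\<in>Basis. (v \<bullet> b) *\<^sub>R f b)"
  using linear_sum[OF assms, of "\<lambda>b. (v \<bullet> b) *\<^sub>R b" Basis]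
  by (simp add: euclidean_representation linear_scale[OF assms])

text \<open>In the chain rule the direction in which \<open>f\<close> is differentiated varies with
  \<open>t\<close>, while the recursion controls only fixed directions. Expanding the direction in
  the basis leaves products of scalar functions with derivatives of \<open>f\<close> in fixed
  directions, composed with \<open>x\<close>.\<close>

lemma Ck_on_compose:
  fixes f :: "'a::euclidean_space \<Rightarrow> 'b::real_normed_vector" and x :: "'c::euclidean_space \<Rightarrow> 'a"
  assumes "open S" and J: "open J" and sub: "\<And>t. t \<in> J \<Longrightarrow> x t \<in> S"
  shows "Ck_on k S f \<Longrightarrow> Ck_on k J x \<Longrightarrow> Ck_on k J (\<lambda>t. f (x t))"
proof (induction k arbitrary: f)
  case 0
  then show ?case using sub by (auto intro: continuous_on_compose2)
next
  case (Suc k)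
  show ?case
  proof (rule Ck_on_SucI[OF J])
    show "((\<lambda>t. f (x t)) has_derivative
        (\<lambda>v. \<Sum>b\<in>Basis. (frechet_derivative x (at t) v \<bullet> b) *\<^sub>R frechet_derivative f (at (x t)) b)) (at t)"
      if t: "t \<in> J" for t
    proof -
      have f: "(f has_derivative frechet_derivative f (at (x t))) (at (x t))"
        using Ck_on_SucE[OF Suc.prems(1)] sub t by blast
      have *: "(\<lambda>v. frechet_derivative f (at (x t)) (frechet_derivative x (at t) v)) =
          (\<lambda>v. \<Sum>b\<in>Basis. (frechet_derivative x (at t) v \<bullet> b) *\<^sub>R frechet_derivative f (at (x t)) b)"
        by (rule ext, rule linear_eq_sum_Basis) (rule has_derivative_linear[OF f])
      show ?thesis
        using diff_chain_at[OF Ck_on_SucE[OF Suc.prems(2) t] f] * by (simp add: o_def)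
    qed
    show "Ck_on k J (\<lambda>t. \<Sum>b\<in>Basis. (frechet_derivative x (at t) v \<bullet> b) *\<^sub>R
        frechet_derivative f (at (x t)) b)" for v
      using Suc.prems Ck_on_SucD[OF Suc.prems(2)]
      by (intro Ck_on_sum[OF J] bounded_bilinear.Ck_on[OF bounded_bilinear_scaleR J]
          bounded_linear.Ck_on[OF bounded_linear_inner_left J] Suc.IH) auto
  qed
qed

section \<open>Closure properties of smooth maps\<close>

lemma smooth_on_cong:
  "open S \<Longrightarrow> smooth_on S f \<Longrightarrow> (\<And>x. x \<in> S \<Longrightarrow> f x = h x) \<Longrightarrow> smooth_on S h"
  unfolding smooth_on_def using Ck_on_cong by blast

lemma smooth_on_const: "open S \<Longrightarrow> smooth_on S (\<lambda>x. a)"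
  by (simp add: smooth_on_def Ck_on_const)

lemma smooth_on_add:
  "open S \<Longrightarrow> smooth_on S f \<Longrightarrow> smooth_on S h \<Longrightarrow> smooth_on S (\<lambda>x. f x + h x)"
  by (simp add: smooth_on_def Ck_on_add)

lemma smooth_on_scaleR:
  "open S \<Longrightarrow> smooth_on S f \<Longrightarrow> smooth_on S h \<Longrightarrow> smooth_on S (\<lambda>x. f x *\<^sub>R h x)"
  by (simp add: smooth_on_def bounded_bilinear.Ck_on[OF bounded_bilinear_scaleR])

lemma smooth_on_mult:
  fixes f h :: "'a::euclidean_space \<Rightarrow> real"
  shows "open S \<Longrightarrow> smooth_on S f \<Longrightarrow> smooth_on S h \<Longrightarrow> smooth_on S (\<lambda>x. f x * h x)"
  by (simp add: smooth_on_def bounded_bilinear.Ck_on[OF bounded_bilinear_mult])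

lemma smooth_on_linear:
  "bounded_linear L \<Longrightarrow> open S \<Longrightarrow> smooth_on S f \<Longrightarrow> smooth_on S (\<lambda>x. L (f x))"
  by (simp add: smooth_on_def bounded_linear.Ck_on)

lemma smooth_on_sum:
  "open S \<Longrightarrow> (\<And>i. i \<in> N \<Longrightarrow> smooth_on S (f i)) \<Longrightarrow> smooth_on S (\<lambda>x. \<Sum>i\<in>N. f i x)"
  by (simp add: smooth_on_def Ck_on_sum)

lemma smooth_on_prod:
  fixes f :: "'i \<Rightarrow> 'a::euclidean_space \<Rightarrow> real"
  shows "open S \<Longrightarrow> (\<And>i. i \<in> N \<Longrightarrow> smooth_on S (f i)) \<Longrightarrow> smooth_on S (\<lambda>x. \<Prod>i\<in>N. f i x)"
  by (simp add: smooth_on_def Ck_on_prod)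

lemma smooth_on_inverse:
  fixes f :: "'a::euclidean_space \<Rightarrow> real"
  shows "open S \<Longrightarrow> (\<And>x. x \<in> S \<Longrightarrow> f x \<noteq> 0) \<Longrightarrow> smooth_on S f \<Longrightarrow> smooth_on S (\<lambda>x. inverse (f x))"
  by (simp add: smooth_on_def Ck_on_inverse)

lemma smooth_on_compose:
  "open S \<Longrightarrow> open J \<Longrightarrow> (\<And>t. t \<in> J \<Longrightarrow> x t \<in> S) \<Longrightarrow> smooth_on S f \<Longrightarrow> smooth_on J x
    \<Longrightarrow> smooth_on J (\<lambda>t. f (x t))"
  by (simp add: smooth_on_def Ck_on_compose)

lemma smooth_on_id: "open S \<Longrightarrow> smooth_on S (\<lambda>x. x)"
  unfolding smooth_on_def
proof
  fix k assume S: "open S"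
  show "Ck_on k S (\<lambda>x. x)"
    by (cases k) (simp, simp only:, intro Ck_on_SucI[OF S has_derivative_ident] Ck_on_const[OF S])
qed

lemma smooth_on_frechet_derivative:
  "smooth_on S f \<Longrightarrow> smooth_on S (\<lambda>x. frechet_derivative f (at x) v)"
  unfolding smooth_on_def using Ck_on.simps(2) by blast

lemma smooth_on_has_derivative:
  assumes "smooth_on S f" and "x \<in> S"
  shows "(f has_derivative frechet_derivative f (at x)) (at x)"
  using assms Ck_on_SucE unfolding smooth_on_def by blast

lemma smooth_on_imp_continuous_on: "smooth_on S f \<Longrightarrow> continuous_on S f"
  unfolding smooth_on_def using Ck_on.simps(1) by blast

lemma smooth_on_has_vector_derivative:
  fixes f :: "real \<Rightarrow> 'b::real_normed_vector"
  assumes "smooth_on S f" and "t \<in> S"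
  shows "(f has_vector_derivative vector_derivative f (at t)) (at t)"
  using smooth_on_has_derivative[OF assms]
  by (simp flip: vector_derivative_works) (blast intro: differentiableI)

lemma smooth_on_vector_derivative:
  fixes f :: "real \<Rightarrow> 'b::real_normed_vector"
  assumes "open S" and "smooth_on S f"
  shows "smooth_on S (\<lambda>t. vector_derivative f (at t))"
proof (rule smooth_on_cong[OF \<open>open S\<close> smooth_on_frechet_derivative[OF assms(2), of 1]])
  fix t assume "t \<in> S"
  then show "frechet_derivative f (at t) 1 = vector_derivative f (at t)"
    using frechet_derivative_at[OF smooth_on_has_vector_derivative[OF assms(2), unfolded has_vector_derivative_def]]
    by (metis scaleR_one)
qed

text \<open>Tensor fields are smooth by definition at fixed arguments only; linearity extends this
  to varying arguments, through the expansion of \<open>V t\<close> in the basis.\<close>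

lemma smooth_on_family_apply:
  fixes B :: "'a::euclidean_space \<Rightarrow> 'c::euclidean_space \<Rightarrow> 'b::real_normed_vector"
  assumes "open S" and "open J" and "\<And>t. t \<in> J \<Longrightarrow> x t \<in> S"
    and "\<And>v. smooth_on S (\<lambda>q. B q v)" and lin: "\<And>q. q \<in> S \<Longrightarrow> linear (B q)"
    and "smooth_on J x" and "smooth_on J V"
  shows "smooth_on J (\<lambda>t. B (x t) (V t))"
proof (rule smooth_on_cong[OF \<open>open J\<close>])
  have "smooth_on J (\<lambda>t. B (x t) b)" for b
    by (rule smooth_on_compose[OF assms(1,2,3,4,6)])
  then show "smooth_on J (\<lambda>t. \<Sum>b\<in>Basis. (V t \<bullet> b) *\<^sub>R B (x t) b)"
    by (intro smooth_on_sum smooth_on_scaleR smooth_on_linear[OF bounded_linear_inner_left] assms)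
qed (simp add: linear_eq_sum_Basis[OF lin[OF assms(3)], symmetric])

text \<open>Linearity in \<open>v\<close> holds at all points near \<open>q\<close>, so it survives
  differentiation in the base point.\<close>

lemma frechet_derivative_linear_param:
  fixes B :: "'a::euclidean_space \<Rightarrow> 'c::euclidean_space \<Rightarrow> 'b::real_normed_vector"
  assumes "open S" and "\<And>v. smooth_on S (\<lambda>q. B q v)" and lin: "\<And>q. q \<in> S \<Longrightarrow> linear (B q)"
    and q: "q \<in> S"
  shows "linear (\<lambda>v. frechet_derivative (\<lambda>p. B p v) (at q) u)"
proof (rule linearI)
  note d = smooth_on_has_derivative[OF assms(2) q]
  note ev = frechet_derivative_transform_within_open[OF differentiableI[OF d] \<open>open S\<close> q]
  fix v w :: 'c and r :: real
  have "frechet_derivative (\<lambda>p. B p (v + w)) (at q) = frechet_derivative (\<lambda>p. B p v + B p w) (at q)"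
    by (rule ev) (use linear_add[OF lin] in blast)
  then show "frechet_derivative (\<lambda>p. B p (v + w)) (at q) u =
      frechet_derivative (\<lambda>p. B p v) (at q) u + frechet_derivative (\<lambda>p. B p w) (at q) u"
    using frechet_derivative_at[OF has_derivative_add[OF d[of v] d[of w]]] by metis
  have "frechet_derivative (\<lambda>p. B p (r *\<^sub>R v)) (at q) = frechet_derivative (\<lambda>p. r *\<^sub>R B p v) (at q)"
    by (rule ev) (use linear_scale[OF lin] in blast)
  then show "frechet_derivative (\<lambda>p. B p (r *\<^sub>R v)) (at q) u =
      r *\<^sub>R frechet_derivative (\<lambda>p. B p v) (at q) u"
    using frechet_derivative_at[OF has_derivative_scaleR_right[OF d[of v], of r]] by metis
qed

text \<open>A product rule: the first term moves the base point with the argument frozen at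
  \<open>V p\<close>, the second moves the argument.\<close>

lemma has_derivative_family_apply:
  fixes B :: "'a::euclidean_space \<Rightarrow> 'c::euclidean_space \<Rightarrow> 'b::real_normed_vector"
  assumes "open S" and sm: "\<And>v. smooth_on S (\<lambda>q. B q v)" and lin: "\<And>q. q \<in> S \<Longrightarrow> linear (B q)"
    and U: "open U" "p \<in> U" and sub: "\<And>p. p \<in> U \<Longrightarrow> F p \<in> S"
    and F: "(F has_derivative F') (at p)" and V: "(V has_derivative V') (at p)"
  shows "((\<lambda>p. B (F p) (V p)) has_derivative
      (\<lambda>u. frechet_derivative (\<lambda>q. B q (V p)) (at (F p)) (F' u) + B (F p) (V' u))) (at p)"
proof -
  have Fp: "F p \<in> S" using sub U by blast
  have B: "((\<lambda>s. B (F s) b) has_derivative (\<lambda>u. frechet_derivative (\<lambda>q. B q b) (at (F p)) (F' u))) (at p)" for b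
    using diff_chain_at[OF F smooth_on_has_derivative[OF sm Fp, of b]] by (simp add: o_def)
  have "((\<lambda>s. \<Sum>b\<in>Basis. (V s \<bullet> b) *\<^sub>R B (F s) b) has_derivative
      (\<lambda>u. \<Sum>b\<in>Basis. (V p \<bullet> b) *\<^sub>R frechet_derivative (\<lambda>q. B q b) (at (F p)) (F' u)
        + (V' u \<bullet> b) *\<^sub>R B (F p) b)) (at p)"
    by (intro has_derivative_sum has_derivative_scaleR B has_derivative_inner_left V)
  moreover have "(\<Sum>b\<in>Basis. (V p \<bullet> b) *\<^sub>R frechet_derivative (\<lambda>q. B q b) (at (F p)) (F' u)
        + (V' u \<bullet> b) *\<^sub>R B (F p) b)
      = frechet_derivative (\<lambda>q. B q (V p)) (at (F p)) (F' u) + B (F p) (V' u)" for u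
    using linear_eq_sum_Basis[OF frechet_derivative_linear_param[OF \<open>open S\<close> sm lin Fp], of "V p" "F' u"]
      linear_eq_sum_Basis[OF lin[OF Fp], of "V' u"] by (simp add: sum.distrib)
  ultimately have "((\<lambda>s. \<Sum>b\<in>Basis. (V s \<bullet> b) *\<^sub>R B (F s) b) has_derivative
      (\<lambda>u. frechet_derivative (\<lambda>q. B q (V p)) (at (F p)) (F' u) + B (F p) (V' u))) (at p)"
    by simp
  then show ?thesis
    by (rule has_derivative_transform_within_open[OF _ U])
       (rule linear_eq_sum_Basis[OF lin[OF sub], symmetric])
qed

section \<open>Symmetry of the second derivative\<close>

text \<open>The mean value theorem is applied once along \<open>u\<close> and once along
  \<open>v\<close>. The left-hand side is symmetric in \<open>u\<close> and \<open>v\<close>, the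
  right-hand side only by what is to be proved from it. The bound on \<open>s\<close> keeps the
  parallelogram inside the ball.\<close>

lemma second_difference:
  fixes f :: "'a::euclidean_space \<Rightarrow> real"
  assumes f: "\<And>x. x \<in> ball q e \<Longrightarrow> (f has_derivative f' x) (at x)"
    and f': "\<And>x. x \<in> ball q e \<Longrightarrow> ((\<lambda>x. f' x u) has_derivative f'' x) (at x)"
    and s: "0 < s" "s * (norm u + norm v) < e"
  shows "\<exists>x\<in>ball q e. f (q + s *\<^sub>R u + s *\<^sub>R v) - f (q + s *\<^sub>R u) - f (q + s *\<^sub>R v) + f q = s\<^sup>2 * f'' x v"
proof -
  have ball: "q + a *\<^sub>R u + b *\<^sub>R v \<in> ball q e" if "0 \<le> a" "a \<le> s" "0 \<le> b" "b \<le> s" for a b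
  proof -
    have "norm (a *\<^sub>R u + b *\<^sub>R v) \<le> a * norm u + b * norm v"
      using norm_triangle_ineq[of "a *\<^sub>R u" "b *\<^sub>R v"] that by simp
    also have "\<dots> \<le> s * (norm u + norm v)"
      using that by (simp add: distrib_left add_mono mult_right_mono)
    finally have "norm (a *\<^sub>R u + b *\<^sub>R v) < e" using s by simp
    then show ?thesis by (simp add: dist_norm norm_minus_commute add.commute add.left_commute)
  qed
  have path: "((\<lambda>a. q + a *\<^sub>R u + b *\<^sub>R v) has_derivative (\<lambda>h. h *\<^sub>R u)) (at a)"
    "((\<lambda>b. q + a *\<^sub>R u + b *\<^sub>R v) has_derivative (\<lambda>h. h *\<^sub>R v)) (at b)" for a b
    by (auto intro!: derivative_eq_intros)
  have d: "((\<lambda>a. f (q + a *\<^sub>R u + b *\<^sub>R v)) has_real_derivative f' (q + a *\<^sub>R u + b *\<^sub>R v) u) (at a)"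
    if "0 \<le> a" "a \<le> s" "0 \<le> b" "b \<le> s" for a b
    using diff_chain_at[OF path(1) f[OF ball[OF that]]]
      linear_scale[OF has_derivative_linear[OF f[OF ball[OF that]]]]
    by (simp add: o_def has_field_derivative_def mult.commute[of _ "f' _ u"])
  have d': "((\<lambda>b. f' (q + a *\<^sub>R u + b *\<^sub>R v) u) has_real_derivative f'' (q + a *\<^sub>R u + b *\<^sub>R v) v) (at b)"
    if "0 \<le> a" "a \<le> s" "0 \<le> b" "b \<le> s" for a b
    using diff_chain_at[OF path(2) f'[OF ball[OF that]]]
      linear_scale[OF has_derivative_linear[OF f'[OF ball[OF that]]]]
    by (simp add: o_def has_field_derivative_def mult.commute[of _ "f'' _ v"])
  \<comment> \<open>The summand \<open>0 *\<^sub>R v\<close> is kept so that both terms have the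
    shape to which \<open>d\<close> applies.\<close>
  let ?h = "\<lambda>a. f (q + a *\<^sub>R u + s *\<^sub>R v) - f (q + a *\<^sub>R u + 0 *\<^sub>R v)"
  have "\<exists>a. 0 < a \<and> a < s \<and> ?h s - ?h 0 = (s - 0) * (f' (q + a *\<^sub>R u + s *\<^sub>R v) u - f' (q + a *\<^sub>R u + 0 *\<^sub>R v) u)"
    using s by (intro MVT2 DERIV_diff d) auto
  then obtain a where a: "0 < a" "a < s"
    "?h s - ?h 0 = s * (f' (q + a *\<^sub>R u + s *\<^sub>R v) u - f' (q + a *\<^sub>R u + 0 *\<^sub>R v) u)" by auto
  have "\<exists>b. 0 < b \<and> b < s \<and> f' (q + a *\<^sub>R u + s *\<^sub>R v) u - f' (q + a *\<^sub>R u + 0 *\<^sub>R v) u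
      = (s - 0) * f'' (q + a *\<^sub>R u + b *\<^sub>R v) v"
    using s a by (intro MVT2 d') auto
  then obtain b where b: "0 < b" "b < s" "f' (q + a *\<^sub>R u + s *\<^sub>R v) u - f' (q + a *\<^sub>R u + 0 *\<^sub>R v) u
      = s * f'' (q + a *\<^sub>R u + b *\<^sub>R v) v" by auto
  have "?h s - ?h 0 = s\<^sup>2 * f'' (q + a *\<^sub>R u + b *\<^sub>R v) v"
    by (simp only: a(3) b(3) power2_eq_square mult.assoc)
  then show ?thesis using ball[of a b] a b by (intro bexI[of _ "q + a *\<^sub>R u + b *\<^sub>R v"]) auto
qed

text \<open>If the mixed derivatives differed at \<open>q\<close>, then by continuity each would
  stay within half the gap of its value at \<open>q\<close> throughout a small ball. But the second
  difference, taken in both orders, makes a value of one equal to a value of the other in that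
  ball.\<close>

lemma second_derivative_symmetric_real:
  fixes f :: "'a::euclidean_space \<Rightarrow> real"
  assumes S: "open S" and f: "smooth_on S f" and q: "q \<in> S"
  shows "frechet_derivative (\<lambda>x. frechet_derivative f (at x) u) (at q) v
       = frechet_derivative (\<lambda>x. frechet_derivative f (at x) v) (at q) u"
proof (rule ccontr)
  define D where "D u v x = frechet_derivative (\<lambda>x. frechet_derivative f (at x) u) (at x) v" for u v x
  assume "\<not> ?thesis"
  then have ne: "0 < \<bar>D u v q - D v u q\<bar> / 2" by (simp add: D_def)
  have "continuous_on S (D u v)" for u v
    unfolding D_def
    by (intro smooth_on_imp_continuous_on smooth_on_frechet_derivative f)
  then have tend: "(D u v \<longlongrightarrow> D u v q) (at q)" for u v
    using S q by (metis continuous_on_eq_continuous_at isContD)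
  have "\<forall>\<^sub>F x in nhds q. dist (D u v x) (D u v q) < \<bar>D u v q - D v u q\<bar> / 2
      \<and> dist (D v u x) (D v u q) < \<bar>D u v q - D v u q\<bar> / 2 \<and> x \<in> S"
    using tend[THEN tendstoD, OF ne] S q ne
    by (intro eventually_conj) (auto simp: eventually_nhds_conv_at intro: eventually_at_in_open')
  then obtain e where e: "0 < e" and ball: "\<And>x. x \<in> ball q e \<Longrightarrow>
      dist (D u v x) (D u v q) < \<bar>D u v q - D v u q\<bar> / 2
      \<and> dist (D v u x) (D v u q) < \<bar>D u v q - D v u q\<bar> / 2 \<and> x \<in> S"
    by (auto simp: eventually_nhds_metric dist_commute)
  \<comment> \<open>The summand 1 keeps the denominator positive and makes the bound required by
    \<open>second_difference\<close> strict.\<close>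
  define s where "s = e / (norm u + norm v + 1)"
  have pos: "0 < norm u + norm v + 1" by (simp add: add_nonneg_pos)
  then have s0: "0 < s" using e by (simp add: s_def)
  have "s * (norm u + norm v + 1) = e" using pos by (simp add: s_def)
  then have s: "s * (norm u + norm v) < e" "s * (norm v + norm u) < e"
    using s0 by (auto simp: algebra_simps)
  note d = smooth_on_has_derivative[OF f] smooth_on_has_derivative[OF smooth_on_frechet_derivative[OF f]]
  have "\<exists>x\<in>ball q e. f (q + s *\<^sub>R u + s *\<^sub>R v) - f (q + s *\<^sub>R u) - f (q + s *\<^sub>R v) + f q = s\<^sup>2 * D u v x"
    unfolding D_def by (rule second_difference) (use d ball s s0 in blast)+
  moreover have "\<exists>x\<in>ball q e. f (q + s *\<^sub>R v + s *\<^sub>R u) - f (q + s *\<^sub>R v) - f (q + s *\<^sub>R u) + f q = s\<^sup>2 * D v u x"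
    unfolding D_def by (rule second_difference) (use d ball s s0 in blast)+
  ultimately obtain x y where xy: "x \<in> ball q e" "y \<in> ball q e" "s\<^sup>2 * D u v x = s\<^sup>2 * D v u y"
    by (auto simp: algebra_simps)
  then have "D u v x = D v u y" using s0 by simp
  moreover have "\<bar>D u v x - D u v q\<bar> < \<bar>D u v q - D v u q\<bar> / 2"
    "\<bar>D v u y - D v u q\<bar> < \<bar>D u v q - D v u q\<bar> / 2"
    using ball xy by (simp_all add: dist_real_def)
  ultimately show False
    using abs_triangle_ineq4[of "D u v x - D u v q" "D v u y - D v u q"]
    by (simp add: abs_minus_commute)
qed

lemma second_derivative_symmetric:
  fixes f :: "'a::euclidean_space \<Rightarrow> 'b::euclidean_space"
  assumes S: "open S" and f: "smooth_on S f" and q: "q \<in> S"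
  shows "frechet_derivative (\<lambda>x. frechet_derivative f (at x) u) (at q) v
       = frechet_derivative (\<lambda>x. frechet_derivative f (at x) v) (at q) u"
proof (rule euclidean_eqI)
  fix b :: 'b
  have inner: "frechet_derivative (\<lambda>x. h x \<bullet> b) (at x) w = frechet_derivative h (at x) w \<bullet> b"
    if "smooth_on S h" "x \<in> S" for h :: "'a \<Rightarrow> 'b" and x w
    using frechet_derivative_at[OF has_derivative_inner_left[OF smooth_on_has_derivative[OF that]]] by metis
  have "frechet_derivative (\<lambda>x. frechet_derivative (\<lambda>x. f x \<bullet> b) (at x) u) (at q) v
      = frechet_derivative (\<lambda>x. frechet_derivative f (at x) u) (at q) v \<bullet> b" for u v
  proof -
    have "frechet_derivative (\<lambda>x. frechet_derivative f (at x) u \<bullet> b) (at q)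
        = frechet_derivative (\<lambda>x. frechet_derivative (\<lambda>x. f x \<bullet> b) (at x) u) (at q)"
      by (rule frechet_derivative_transform_within_open[OF differentiableI[OF has_derivative_inner_left[OF
            smooth_on_has_derivative[OF smooth_on_frechet_derivative[OF f] q]]] S q])
         (simp add: inner[OF f])
    then show ?thesis using inner[OF smooth_on_frechet_derivative[OF f] q] by metis
  qed
  then show "frechet_derivative (\<lambda>x. frechet_derivative f (at x) u) (at q) v \<bullet> b
       = frechet_derivative (\<lambda>x. frechet_derivative f (at x) v) (at q) u \<bullet> b"
    using second_derivative_symmetric_real[OF S smooth_on_linear[OF bounded_linear_inner_left S f] q] by metis
qed

section \<open>The Levi-Civita connection in a chart\<close>

lemma smooth_on_det:
  fixes M :: "'a::euclidean_space \<Rightarrow> real^'n^'n"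
  assumes "open S" and "\<And>i j. smooth_on S (\<lambda>q. M q $ i $ j)"
  shows "smooth_on S (\<lambda>q. det (M q))"
  unfolding det_def
  by (intro smooth_on_sum smooth_on_mult smooth_on_const smooth_on_prod assms)

lemma smooth_on_vec:
  fixes z :: "'a::euclidean_space \<Rightarrow> real^'n"
  assumes "open S" and "\<And>i. smooth_on S (\<lambda>q. z q $ i)"
  shows "smooth_on S z"
proof (rule smooth_on_cong[OF \<open>open S\<close>])
  show "smooth_on S (\<lambda>q. \<Sum>i\<in>UNIV. (z q $ i) *\<^sub>R axis i 1)"
    by (intro smooth_on_sum smooth_on_scaleR smooth_on_const assms)
  show "(\<Sum>i\<in>UNIV. (z q $ i) *\<^sub>R axis i 1) = z q" for q
    using basis_expansion[of "z q"] by (simp add: scalar_mult_eq_scaleR)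
qed

text \<open>Cramer's rule makes each component a quotient of determinants, which are polynomials in
  smooth entries. Regularity of \<open>z\<close> is a conclusion, as suits a vector known only
  through an equation.\<close>

lemma smooth_on_linear_system:
  fixes M :: "'a::euclidean_space \<Rightarrow> real^'n^'n"
  assumes S: "open S" and M: "\<And>i j. smooth_on S (\<lambda>q. M q $ i $ j)"
    and b: "\<And>i. smooth_on S (\<lambda>q. b q $ i)"
    and det: "\<And>q. q \<in> S \<Longrightarrow> det (M q) \<noteq> 0" and sol: "\<And>q. q \<in> S \<Longrightarrow> M q *v z q = b q"
  shows "smooth_on S z"
proof (rule smooth_on_vec[OF S], rule smooth_on_cong[OF S])
  fix k
  show "smooth_on S (\<lambda>q. det (\<chi> i j. if j = k then b q $ i else M q $ i $ j) * inverse (det (M q)))"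
  proof (intro smooth_on_mult smooth_on_inverse smooth_on_det S M det)
    fix i j
    show "smooth_on S (\<lambda>q. (\<chi> i j. if j = k then b q $ i else M q $ i $ j) $ i $ j)"
      by (cases "j = k") (simp_all add: M b)
  qed
  fix q assume "q \<in> S"
  then show "det (\<chi> i j. if j = k then b q $ i else M q $ i $ j) * inverse (det (M q)) = z q $ k"
    using cramer[OF det, of q "z q" "b q"] sol by (simp add: vec_eq_iff field_simps)
qed

text \<open>The connection induced on the pullback of the tangent bundle by \<open>F\<close>. The
  general domain serves three cases: \<open>F\<close> is a curve, the identity of a chart, or a
  change of charts.\<close>

definition pullback_nabla ::
    "('e::euclidean_space \<Rightarrow> 'e \<Rightarrow> 'e \<Rightarrow> real) \<Rightarrow> ('c::euclidean_space \<Rightarrow> 'e) \<Rightarrow> ('c \<Rightarrow> 'e) \<Rightarrow>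
     'c \<Rightarrow> 'c \<Rightarrow> 'e" where
  "pullback_nabla G F V u p =
     frechet_derivative V (at p) u + christoffel G (F p) (frechet_derivative F (at p) u) (V p)"

locale metric_chart =
  fixes \<Omega> :: "(real^'n) set" and G :: "real^'n \<Rightarrow> real^'n \<Rightarrow> real^'n \<Rightarrow> real"
  assumes open_dom: "open \<Omega>" and metric: "metric_on \<Omega> G"
begin

abbreviation "\<Gamma> \<equiv> christoffel G"

lemma smooth_metric: "smooth_on \<Omega> (\<lambda>q. G q u v)"
  using metric by (simp add: metric_on_def)

lemma linear_metric_right: "q \<in> \<Omega> \<Longrightarrow> linear (G q u)"
  and linear_metric_left: "q \<in> \<Omega> \<Longrightarrow> linear (\<lambda>u. G q u v)"
  using metric by (auto simp: metric_on_def bilinear_def)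

lemma metric_commute: "q \<in> \<Omega> \<Longrightarrow> G q u v = G q v u"
  using metric by (auto simp: metric_on_def)

lemma metric_pos: "q \<in> \<Omega> \<Longrightarrow> v \<noteq> 0 \<Longrightarrow> 0 < G q v v"
  using metric by (auto simp: metric_on_def)

lemmas metric_simps =
  linear_add[OF linear_metric_right] linear_scale[OF linear_metric_right, unfolded real_scaleR_def]
  linear_diff[OF linear_metric_right] linear_neg[OF linear_metric_right] linear_0[OF linear_metric_right]
  linear_add[OF linear_metric_left] linear_scale[OF linear_metric_left, unfolded real_scaleR_def]
  linear_diff[OF linear_metric_left] linear_neg[OF linear_metric_left] linear_0[OF linear_metric_left]

lemma metric_nondegenerate:
  assumes q: "q \<in> \<Omega>" and "\<And>w. G q a w = G q b w"
  shows "a = b"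
proof (rule ccontr)
  assume "a \<noteq> b"
  then have "0 < G q (a - b) (a - b)" using metric_pos[OF q] by simp
  then show False using assms(2)[of "a - b"] by (simp add: metric_simps q)
qed

lemmas christoffel_eq = christoffel_equation[OF metric open_dom]

lemma linear_frechet_derivative_metric:
  assumes "q \<in> \<Omega>"
  shows "linear (\<lambda>w. frechet_derivative (\<lambda>p. G p v w) (at q) u)"
  by (rule frechet_derivative_linear_param[OF open_dom smooth_metric linear_metric_right assms])

lemma christoffel_commute: "q \<in> \<Omega> \<Longrightarrow> \<Gamma> q u v = \<Gamma> q v u"
  using nabla_torsion_free[OF metric open_dom, of q "\<lambda>_. u" "\<lambda>_. v"]
  by (simp add: nabla_def lie_bracket_def frechet_derivative_const)

lemma linear_christoffel_left:
  assumes q: "q \<in> \<Omega>"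
  shows "linear (\<lambda>u. \<Gamma> q u v)"
proof -
  note lin = linear_frechet_derivative_metric[OF q]
    linear_frechet_derivative[OF differentiableI[OF smooth_on_has_derivative[OF smooth_metric q]]]
  \<comment> \<open>Koszul's formula contains the first argument of \<Gamma> both as a direction and
    inside \<open>G\<close>; the swap moves the latter into the slot in which \<open>lin(1)\<close>
    gives linearity.\<close>
  have sym: "frechet_derivative (\<lambda>p. G p u v) (at q) = frechet_derivative (\<lambda>p. G p v u) (at q)" for u v
    by (rule frechet_derivative_metric_sym[OF metric open_dom q])
  show ?thesis
  proof (rule linearI; rule metric_nondegenerate[OF q])
    fix a b w :: "real^'n" and r :: real
    have "2 * G q (\<Gamma> q (a + b) v) w = 2 * G q (\<Gamma> q a v + \<Gamma> q b v) w"
      using christoffel_eq[OF q, of a v w] christoffel_eq[OF q, of b v w]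
      unfolding christoffel_eq[OF q, of "a + b" v w] sym[of _ v]
      by (simp add: linear_add[OF lin(1)] linear_add[OF lin(2)] metric_simps q sym[of _ w])
    then show "G q (\<Gamma> q (a + b) v) w = G q (\<Gamma> q a v + \<Gamma> q b v) w" by simp
    have "2 * G q (\<Gamma> q (r *\<^sub>R a) v) w = 2 * G q (r *\<^sub>R \<Gamma> q a v) w"
      using arg_cong[OF christoffel_eq[OF q, of a v w], of "(*) r"]
      unfolding christoffel_eq[OF q, of "r *\<^sub>R a" v w] sym[of _ v]
      by (simp add: linear_scale[OF lin(1)] linear_scale[OF lin(2)] metric_simps q sym[of _ w] algebra_simps)
    then show "G q (\<Gamma> q (r *\<^sub>R a) v) w = G q (r *\<^sub>R \<Gamma> q a v) w" by simp
  qed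
qed

lemma linear_christoffel_right:
  assumes q: "q \<in> \<Omega>"
  shows "linear (\<Gamma> q u)"
  using linear_christoffel_left[OF q, of u] christoffel_commute[OF q, of u]
  by (metis (no_types, lifting) ext)

lemmas christoffel_simps =
  linear_add[OF linear_christoffel_right] linear_scale[OF linear_christoffel_right]
  linear_0[OF linear_christoffel_right]
  linear_add[OF linear_christoffel_left] linear_scale[OF linear_christoffel_left]
  linear_0[OF linear_christoffel_left]

text \<open>Koszul's formula is a linear system for the components of \<open>\<Gamma>\<^sub>q(u, v)\<close> whose matrix is the
  Gram matrix of the metric.\<close>

lemma smooth_christoffel: "smooth_on \<Omega> (\<lambda>q. \<Gamma> q u v)"
proof (rule smooth_on_linear_system[OF open_dom])
  let ?M = "\<lambda>q. (\<chi> i j. G q (axis j 1) (axis i 1)) :: real^'n^'n"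
  let ?b = "\<lambda>q. (\<chi> i. (1/2) * (frechet_derivative (\<lambda>p. G p v (axis i 1)) (at q) u
      + frechet_derivative (\<lambda>p. G p u (axis i 1)) (at q) v
      + (-1) * frechet_derivative (\<lambda>p. G p u v) (at q) (axis i 1))) :: real^'n"
  have M: "(?M q *v z) $ i = G q z (axis i 1)" if q: "q \<in> \<Omega>" for q z i
  proof -
    have "G q z (axis i 1) = G q (\<Sum>j\<in>UNIV. z $ j *\<^sub>R axis j 1) (axis i 1)"
      using basis_expansion[of z] by (simp add: scalar_mult_eq_scaleR)
    also have "\<dots> = (\<Sum>j\<in>UNIV. z $ j * G q (axis j 1) (axis i 1))"
      by (simp add: linear_sum[OF linear_metric_left[OF q]] metric_simps q)
    finally show ?thesis by (simp add: matrix_vector_mult_def mult.commute)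
  qed
  show "smooth_on \<Omega> (\<lambda>q. ?M q $ i $ j)" for i j
    by (simp add: smooth_metric)
  show "smooth_on \<Omega> (\<lambda>q. ?b q $ i)" for i
    unfolding vec_lambda_beta
    by (intro smooth_on_mult smooth_on_add smooth_on_const smooth_on_frechet_derivative smooth_metric open_dom)
  fix q assume q: "q \<in> \<Omega>"
  \<comment> \<open>A kernel vector is \<open>G\<close>-orthogonal to the standard basis, hence to
    every vector.\<close>
  have "z = 0" if "?M q *v z = 0" for z
  proof (rule metric_nondegenerate[OF q])
    have "G q z (axis i 1) = 0" for i using M[OF q, of z i] that by simp
    then show "G q z w = G q 0 w" for w
      using basis_expansion[of w] linear_sum[OF linear_metric_right[OF q], of z "\<lambda>i. w $ i *s axis i 1" UNIV]
      by (simp add: scalar_mult_eq_scaleR metric_simps q)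
  qed
  then show "det (?M q) \<noteq> 0"
    by (metis invertible_det_nz invertible_left_inverse matrix_left_invertible_ker)
  have "G q (\<Gamma> q u v) (axis i 1) = ?b q $ i" for i
    using christoffel_eq[OF q, of u v "axis i 1"] by simp
  then show "?M q *v \<Gamma> q u v = ?b q"
    by (simp only: vec_eq_iff M[OF q] simp_thms)
qed

lemma frechet_derivative_metric:
  assumes q: "q \<in> \<Omega>"
  shows "frechet_derivative (\<lambda>p. G p v w) (at q) u = G q (\<Gamma> q u v) w + G q v (\<Gamma> q u w)"
  using nabla_metric[OF metric open_dom q, of "\<lambda>_. u" v w]
  by (simp add: nabla_def vf_apply_def frechet_derivative_const)

lemma smooth_metric_along:
  assumes "open U" and sub: "\<And>p. p \<in> U \<Longrightarrow> F p \<in> \<Omega>" and "smooth_on U F"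
    and "smooth_on U V" and "smooth_on U W"
  shows "smooth_on U (\<lambda>p. G (F p) (V p) (W p))"
proof (rule smooth_on_family_apply[where B = "\<lambda>p w. G (F p) (V p) w" and x = "\<lambda>p. p"])
  show "smooth_on U (\<lambda>p. G (F p) (V p) w)" for w
    by (rule smooth_on_family_apply[where B = "\<lambda>q v. G q v w", OF open_dom])
       (use assms smooth_metric linear_metric_left in auto)
qed (use assms linear_metric_right in \<open>auto simp: smooth_on_id\<close>)

lemma smooth_christoffel_along:
  assumes "open U" and sub: "\<And>p. p \<in> U \<Longrightarrow> F p \<in> \<Omega>" and "smooth_on U F"
    and "smooth_on U V" and "smooth_on U W"
  shows "smooth_on U (\<lambda>p. \<Gamma> (F p) (V p) (W p))"
proof (rule smooth_on_family_apply[where B = "\<lambda>p w. \<Gamma> (F p) (V p) w" and x = "\<lambda>p. p"])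
  show "smooth_on U (\<lambda>p. \<Gamma> (F p) (V p) w)" for w
    by (rule smooth_on_family_apply[where B = "\<lambda>q v. \<Gamma> q v w", OF open_dom])
       (use assms smooth_christoffel linear_christoffel_left in auto)
qed (use assms linear_christoffel_right in \<open>auto simp: smooth_on_id\<close>)

text \<open>The point \<open>p\<close> enters in three places, so the product rule for families is
  used twice: first for \<open>W\<close> with the vector \<open>v\<close> fixed, then for
  \<open>V\<close> with base point and \<open>W\<close> absorbed into the family. Metric
  compatibility splits the derivative of the base point between the two summands.\<close>

lemma frechet_derivative_metric_along:
  assumes U: "open U" "p \<in> U" and sub: "\<And>p. p \<in> U \<Longrightarrow> F p \<in> \<Omega>"
    and F: "smooth_on U F" and V: "smooth_on U V" and W: "smooth_on U W"
  shows "frechet_derivative (\<lambda>p. G (F p) (V p) (W p)) (at p) u =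
      G (F p) (pullback_nabla G F V u p) (W p) + G (F p) (V p) (pullback_nabla G F W u p)"
proof -
  note d = smooth_on_has_derivative[OF _ U(2)]
  have Fp: "F p \<in> \<Omega>" using sub U by blast
  have 1: "((\<lambda>p. G (F p) v (W p)) has_derivative
      (\<lambda>u. frechet_derivative (\<lambda>q. G q v (W p)) (at (F p)) (frechet_derivative F (at p) u)
        + G (F p) v (frechet_derivative W (at p) u))) (at p)" for v
    by (rule has_derivative_family_apply[where B = "\<lambda>q. G q v", OF open_dom smooth_metric linear_metric_right
          U sub d[OF F] d[OF W]])
  have "((\<lambda>p'. (\<lambda>q v. G (F q) v (W q)) p' (V p')) has_derivative
      (\<lambda>u. frechet_derivative (\<lambda>q. G (F q) (V p) (W q)) (at p) u + G (F p) (frechet_derivative V (at p) u) (W p))) (at p)"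
    by (rule has_derivative_family_apply[where F = "\<lambda>p. p" and F' = "\<lambda>u. u", OF U(1) _ _ U _ _ d[OF V]])
       (use sub linear_metric_left smooth_metric_along[OF U(1) sub F smooth_on_const[OF U(1)] W] in auto)
  from fun_cong[OF frechet_derivative_at[OF this], of u] fun_cong[OF frechet_derivative_at[OF 1, of "V p"], of u]
  have "frechet_derivative (\<lambda>p. G (F p) (V p) (W p)) (at p) u =
      frechet_derivative (\<lambda>q. G q (V p) (W p)) (at (F p)) (frechet_derivative F (at p) u)
        + G (F p) (V p) (frechet_derivative W (at p) u) + G (F p) (frechet_derivative V (at p) u) (W p)"
    by simp
  then show ?thesis
    by (simp add: frechet_derivative_metric Fp pullback_nabla_def metric_simps)
qed

section \<open>Two properties of the curvature tensor\<close>

lemma curvature_at_eq: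
  assumes q: "q \<in> \<Omega>"
  shows "curvature_at G q u v w =
      frechet_derivative (\<lambda>p. \<Gamma> p v w) (at q) u + \<Gamma> q u (\<Gamma> q v w)
      - (frechet_derivative (\<lambda>p. \<Gamma> p u w) (at q) v + \<Gamma> q v (\<Gamma> q u w))"
proof -
  have "nabla G (\<lambda>_. v) (\<lambda>_. w) = (\<lambda>p. \<Gamma> p v w)" for v w
    by (simp add: fun_eq_iff nabla_def frechet_derivative_const)
  then show ?thesis
    by (simp add: curvature_at_def curvature_def nabla_def lie_bracket_def frechet_derivative_const
        christoffel_simps q)
qed

text \<open>Pulls \<kappa> out of R(\<kappa>N, T)T in the bitension field.\<close>

lemma curvature_at_scaleR:
  assumes q: "q \<in> \<Omega>"
  shows "curvature_at G q (r *\<^sub>R u) v w = r *\<^sub>R curvature_at G q u v w"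
proof -
  have "linear (\<lambda>u. frechet_derivative (\<lambda>p. \<Gamma> p u w) (at q) v)"
    by (rule frechet_derivative_linear_param[OF open_dom smooth_christoffel linear_christoffel_left q])
  moreover have "linear (frechet_derivative (\<lambda>p. \<Gamma> p v w) (at q))"
    by (rule has_derivative_linear[OF smooth_on_has_derivative[OF smooth_christoffel q]])
  ultimately show ?thesis
    by (simp add: curvature_at_eq q christoffel_simps linear_scale[of "\<lambda>u. frechet_derivative (\<lambda>p. \<Gamma> p u w) (at q) v"]
        linear_scale scaleR_diff_right scaleR_add_right)
qed

text \<open>Both second covariant derivatives are compared with the second derivatives of \<open>G(w, w)\<close>,
  which commute.\<close>

lemma metric_curvature_at_same:
  assumes q: "q \<in> \<Omega>"
  shows "G q (curvature_at G q u v w) w = 0"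
proof -
  have id: "frechet_derivative (\<lambda>p :: real^'n. p) (at q) u = u" for u
    using frechet_derivative_at[OF has_derivative_ident, of q] by metis
  \<comment> \<open>By metric compatibility \<open>G p (\<Gamma> p v w) w\<close> is half the
    derivative of \<open>G p w w\<close> along \<open>v\<close>. The product subtracted on the right
    is symmetric in \<open>u\<close> and \<open>v\<close>, so it cancels as well.\<close>
  have "G q (frechet_derivative (\<lambda>p. \<Gamma> p v w) (at q) u + \<Gamma> q u (\<Gamma> q v w)) w
      = (1/2) * frechet_derivative (\<lambda>p. frechet_derivative (\<lambda>p. G p w w) (at p) v) (at q) u
        - G q (\<Gamma> q v w) (\<Gamma> q u w)" for u v
  proof -
    have "G p (\<Gamma> p v w) w = (1/2) * frechet_derivative (\<lambda>p. G p w w) (at p) v" if "p \<in> \<Omega>" for p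
      using that by (simp add: frechet_derivative_metric metric_commute[OF that, of w])
    then have 1: "frechet_derivative (\<lambda>p. (1/2) * frechet_derivative (\<lambda>p. G p w w) (at p) v) (at q)
        = frechet_derivative (\<lambda>p. G p (\<Gamma> p v w) w) (at q)"
      by (intro frechet_derivative_transform_within_open[OF _ open_dom q]
          differentiableI[OF smooth_on_has_derivative[OF _ q]] smooth_on_mult smooth_on_const
          smooth_on_frechet_derivative smooth_metric open_dom) simp
    have 2: "frechet_derivative (\<lambda>p. (1/2) * frechet_derivative (\<lambda>p. G p w w) (at p) v) (at q)
        = (\<lambda>u. (1/2) * frechet_derivative (\<lambda>p. frechet_derivative (\<lambda>p. G p w w) (at p) v) (at q) u)"
      by (rule frechet_derivative_at[symmetric], intro has_derivative_mult_right smooth_on_has_derivative[OF _ q]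
          smooth_on_frechet_derivative smooth_metric)
    have "frechet_derivative (\<lambda>p. G p (\<Gamma> p v w) w) (at q) u =
        G q (frechet_derivative (\<lambda>p. \<Gamma> p v w) (at q) u + \<Gamma> q u (\<Gamma> q v w)) w + G q (\<Gamma> q v w) (\<Gamma> q u w)"
      using frechet_derivative_metric_along[OF open_dom q _ smooth_on_id[OF open_dom] smooth_christoffel
          smooth_on_const[OF open_dom], of v w w u]
      by (simp add: pullback_nabla_def id frechet_derivative_const)
    then show ?thesis using fun_cong[OF 1, of u] fun_cong[OF 2, of u] by linarith
  qed
  note this[of v u] this[of u v]
  moreover have "G q (\<Gamma> q v w) (\<Gamma> q u w) = G q (\<Gamma> q u w) (\<Gamma> q v w)"
    by (rule metric_commute[OF q])
  ultimately show ?thesis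
    using second_derivative_symmetric[OF open_dom smooth_metric q, of w w u v]
    by (simp add: curvature_at_eq[OF q] metric_simps q)
qed

end

section \<open>Covariant derivatives along a curve in a chart\<close>

text \<open>\<open>J\<close> is an open set rather than an interval because a curve may leave a
  chart and come back.\<close>

locale metric_curve = metric_chart \<Omega> G for \<Omega> :: "(real^'n) set" and G +
  fixes J :: "real set" and x :: "real \<Rightarrow> real^'n"
  assumes open_J: "open J" and smooth_x: "smooth_on J x" and x_in: "t \<in> J \<Longrightarrow> x t \<in> \<Omega>"
begin

definition T :: "real \<Rightarrow> real^'n" where
  "T t = vector_derivative x (at t)"

definition D :: "(real \<Rightarrow> real^'n) \<Rightarrow> real \<Rightarrow> real^'n" where
  "D V t = vector_derivative V (at t) + \<Gamma> (x t) (T t) (V t)"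

lemma frechet_derivative_one:
  fixes V :: "real \<Rightarrow> 'b::real_normed_vector"
  assumes "smooth_on J V" and "t \<in> J"
  shows "frechet_derivative V (at t) 1 = vector_derivative V (at t)"
  using frechet_derivative_at[OF smooth_on_has_vector_derivative[OF assms, unfolded has_vector_derivative_def]]
  by (metis scaleR_one)

lemma D_eq_pullback_nabla:
  "smooth_on J V \<Longrightarrow> t \<in> J \<Longrightarrow> D V t = pullback_nabla G x V 1 t"
  by (simp add: D_def T_def pullback_nabla_def frechet_derivative_one smooth_x)

lemma smooth_T: "smooth_on J T"
  using smooth_on_vector_derivative[OF open_J smooth_x] by (simp add: T_def[abs_def])

lemma smooth_D: "smooth_on J V \<Longrightarrow> smooth_on J (D V)"
  unfolding D_def[abs_def]
  by (intro smooth_on_add smooth_on_vector_derivative smooth_christoffel_along smooth_T smooth_x x_in open_J)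

lemma smooth_G: "smooth_on J V \<Longrightarrow> smooth_on J W \<Longrightarrow> smooth_on J (\<lambda>t. G (x t) (V t) (W t))"
  by (intro smooth_metric_along smooth_x x_in open_J)

lemma vector_derivative_G:
  assumes "smooth_on J V" and "smooth_on J W" and "t \<in> J"
  shows "vector_derivative (\<lambda>t. G (x t) (V t) (W t)) (at t) = G (x t) (D V t) (W t) + G (x t) (V t) (D W t)"
  using frechet_derivative_metric_along[OF open_J \<open>t \<in> J\<close> x_in smooth_x assms(1,2), of 1]
    frechet_derivative_one[OF smooth_G[OF assms(1,2)] \<open>t \<in> J\<close>] assms
  by (simp add: D_eq_pullback_nabla)

lemma vector_derivative_cong:
  fixes V :: "real \<Rightarrow> 'b::real_normed_vector"
  assumes "\<And>s. s \<in> J \<Longrightarrow> V s = W s" and "t \<in> J"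
  shows "vector_derivative V (at t) = vector_derivative W (at t)"
  by (rule vector_derivative_cong_eq)
     (use assms open_J in \<open>auto simp: eventually_nhds\<close>)

lemma D_cong: "(\<And>s. s \<in> J \<Longrightarrow> V s = W s) \<Longrightarrow> t \<in> J \<Longrightarrow> D V t = D W t"
  by (simp add: D_def vector_derivative_cong[of V W])

lemma D_add:
  assumes "smooth_on J V" and "smooth_on J W" and "t \<in> J"
  shows "D (\<lambda>t. V t + W t) t = D V t + D W t"
  using vector_derivative_at[OF has_vector_derivative_add[OF smooth_on_has_vector_derivative[OF assms(1,3)]
        smooth_on_has_vector_derivative[OF assms(2,3)]]]
  by (simp add: D_def christoffel_simps x_in \<open>t \<in> J\<close>)

lemma D_scaleR:
  assumes f: "smooth_on J f" and "smooth_on J V" and t: "t \<in> J"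
  shows "D (\<lambda>t. f t *\<^sub>R V t) t = vector_derivative f (at t) *\<^sub>R V t + f t *\<^sub>R D V t"
proof -
  have "(f has_real_derivative vector_derivative f (at t)) (at t)"
    using smooth_on_has_vector_derivative[OF f t] by (simp add: has_real_derivative_iff_has_vector_derivative)
  from vector_derivative_at[OF has_vector_derivative_scaleR[OF this smooth_on_has_vector_derivative[OF assms(2) t]]]
  show ?thesis by (simp add: D_def christoffel_simps x_in t scaleR_add_right)
qed

lemma vector_derivative_family:
  fixes B :: "real^'n \<Rightarrow> 'c::euclidean_space \<Rightarrow> 'b::real_normed_vector"
  assumes "\<And>v. smooth_on \<Omega> (\<lambda>q. B q v)" and "\<And>q. q \<in> \<Omega> \<Longrightarrow> linear (B q)"
    and "smooth_on J V" and t: "t \<in> J"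
  shows "vector_derivative (\<lambda>t. B (x t) (V t)) (at t) =
      frechet_derivative (\<lambda>q. B q (V t)) (at (x t)) (T t) + B (x t) (vector_derivative V (at t))"
proof -
  note d = has_derivative_family_apply[OF open_dom assms(1,2) open_J t x_in
      smooth_on_has_derivative[OF smooth_x t] smooth_on_has_derivative[OF assms(3) t]]
  have "smooth_on J (\<lambda>t. B (x t) (V t))"
    by (rule smooth_on_family_apply[OF open_dom open_J x_in assms(1,2) smooth_x assms(3)])
  from frechet_derivative_one[OF this t] fun_cong[OF frechet_derivative_at[OF d], of 1]
  show ?thesis
    by (simp add: frechet_derivative_one smooth_x assms(3) t T_def)
qed

end

text \<open>The transformation law \<open>dF(\<Gamma>(u, v)) = D\<^sup>2F(u, v) + \<Gamma>'(dF u, dF v)\<close>, tested against the vectors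
  \<open>dF w\<close> only, so that \<open>dF\<close> need not be known to be onto.  It follows from Koszul's formula because
  \<open>D\<^sup>2F\<close> is symmetric.\<close>

lemma metric_christoffel_transform:
  fixes \<Omega> \<Omega>' U :: "(real^'n) set"
  assumes "metric_chart \<Omega> G" and "metric_chart \<Omega>' G'"
    and U: "open U" "q \<in> U" "U \<subseteq> \<Omega>" and F: "smooth_on U F" "\<And>p. p \<in> U \<Longrightarrow> F p \<in> \<Omega>'"
    and iso: "\<And>p u v. p \<in> U \<Longrightarrow>
      G' (F p) (frechet_derivative F (at p) u) (frechet_derivative F (at p) v) = G p u v"
  shows "G q (christoffel G q u v) w =
      G' (F q) (pullback_nabla G' F (\<lambda>p. frechet_derivative F (at p) v) u q) (frechet_derivative F (at q) w)"
proof -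
  interpret g: metric_chart \<Omega> G by fact
  interpret g': metric_chart \<Omega>' G' by fact
  define P where "P u v = pullback_nabla G' F (\<lambda>p. frechet_derivative F (at p) v) u q" for u v
  define A where "A = frechet_derivative F (at q)"
  have q: "q \<in> \<Omega>" "F q \<in> \<Omega>'" using U F by auto
  have P: "P u v = P v u" for u v
    using second_derivative_symmetric[OF U(1) F(1) U(2), of u v] g'.christoffel_commute[OF q(2)]
    by (simp add: P_def pullback_nabla_def)
  \<comment> \<open>This is the derivative of the isometry law. In Koszul's combination of its three
    permutations the symmetry of \<open>P\<close> cancels everything but twice
    \<open>G' (F q) (P u v) (A w)\<close>.\<close>
  have "frechet_derivative (\<lambda>p. G p v w) (at q) u = G' (F q) (P u v) (A w) + G' (F q) (A v) (P u w)" for u v w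
  proof -
    have "frechet_derivative (\<lambda>p. G p v w) (at q) =
      frechet_derivative (\<lambda>p. G' (F p) (frechet_derivative F (at p) v) (frechet_derivative F (at p) w)) (at q)"
      by (rule frechet_derivative_transform_within_open[OF _ U(1,2)])
         (use smooth_on_has_derivative[OF g.smooth_metric q(1)] iso in \<open>auto simp: differentiable_def\<close>)
    then show ?thesis
      using g'.frechet_derivative_metric_along[OF U(1,2) F(2,1) smooth_on_frechet_derivative[OF F(1)]
          smooth_on_frechet_derivative[OF F(1)], of v w u]
      by (simp add: P_def A_def)
  qed
  then show ?thesis
    using g.christoffel_eq[OF q(1), of u v w] P[of v u] P[of w u] P[of w v]
      g'.metric_commute[OF q(2), of "A v"] g'.metric_commute[OF q(2), of "A u"]
    by (simp flip: P_def A_def)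
qed

text \<open>The velocity transforms by the chain rule. Differentiating that law along the curve
  produces a second derivative of \<open>F\<close>, and it is exactly the inhomogeneous term in the
  transformation of the Christoffel symbols. \<open>K\<close> is the set of parameters where both
  charts can be compared.\<close>

lemma metric_D_T_transform:
  fixes \<Omega> \<Omega>' U :: "(real^'n) set"
  assumes "metric_curve \<Omega> G J x" and "metric_curve \<Omega>' G' J' y"
    and U: "open U" "U \<subseteq> \<Omega>" and F: "smooth_on U F" "\<And>p. p \<in> U \<Longrightarrow> F p \<in> \<Omega>'"
    and iso: "\<And>p u v. p \<in> U \<Longrightarrow>
      G' (F p) (frechet_derivative F (at p) u) (frechet_derivative F (at p) v) = G p u v"
    and K: "open K" "t \<in> K" "K \<subseteq> J" "K \<subseteq> J'" and xy: "\<And>s. s \<in> K \<Longrightarrow> x s \<in> U \<and> y s = F (x s)"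
  shows "metric_curve.T y t = frechet_derivative F (at (x t)) (metric_curve.T x t)" (is ?T)
    and "G' (y t) (metric_curve.D G' y (metric_curve.T y) t) (frechet_derivative F (at (x t)) w) =
      G (x t) (metric_curve.D G x (metric_curve.T x) t) w" (is ?D)
proof -
  interpret a: metric_curve \<Omega> G J x by fact
  interpret b: metric_curve \<Omega>' G' J' y by fact
  let ?A = "\<lambda>p. frechet_derivative F (at p)"
  have lin: "linear (?A p)" if "p \<in> U" for p
    by (rule has_derivative_linear[OF smooth_on_has_derivative[OF F(1) that]])
  have T: "b.T s = ?A (x s) (a.T s)" if s: "s \<in> K" for s
  proof -
    have "(x has_vector_derivative a.T s) (at s)"
      using smooth_on_has_vector_derivative[OF a.smooth_x] s K by (auto simp: a.T_def)
    from vector_derivative_diff_chain_within[OF this has_derivative_at_withinI[OF smooth_on_has_derivative[OF F(1)]]]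
    have "((\<lambda>s. F (x s)) has_vector_derivative ?A (x s) (a.T s)) (at s)"
      using xy s by (simp add: o_def)
    from has_vector_derivative_transform_within_open[OF this K(1) s, of y]
    show ?thesis using xy by (auto simp: b.T_def intro: vector_derivative_at)
  qed
  show ?T by (rule T[OF K(2)])
  have t: "t \<in> J" "t \<in> J'" "x t \<in> U" "y t = F (x t)" "x t \<in> \<Omega>" using K U xy by auto
  have "((\<lambda>s. ?A (x s) (a.T s)) has_derivative
      (\<lambda>u. frechet_derivative (\<lambda>q. ?A q (a.T t)) (at (x t)) (frechet_derivative x (at t) u)
        + ?A (x t) (frechet_derivative a.T (at t) u))) (at t)"
    by (rule has_derivative_family_apply[where B = ?A, OF U(1) smooth_on_frechet_derivative[OF F(1)] lin K(1,2) _
          smooth_on_has_derivative[OF a.smooth_x t(1)] smooth_on_has_derivative[OF a.smooth_T t(1)]])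
       (use xy in auto)
  then have "(b.T has_derivative
      (\<lambda>u. frechet_derivative (\<lambda>q. ?A q (a.T t)) (at (x t)) (frechet_derivative x (at t) u)
        + ?A (x t) (frechet_derivative a.T (at t) u))) (at t)"
    by (rule has_derivative_transform_within_open[OF _ K(1,2)]) (use T in auto)
  from fun_cong[OF frechet_derivative_at[OF this], of 1]
  have "vector_derivative b.T (at t) = frechet_derivative (\<lambda>q. ?A q (a.T t)) (at (x t)) (a.T t)
      + ?A (x t) (vector_derivative a.T (at t))"
    by (simp add: b.frechet_derivative_one[OF b.smooth_T t(2)] a.frechet_derivative_one[OF a.smooth_T t(1)]
        a.frechet_derivative_one[OF a.smooth_x t(1)] a.T_def[symmetric])
  then have "b.D b.T t = pullback_nabla G' F (\<lambda>p. ?A p (a.T t)) (a.T t) (x t) + ?A (x t) (vector_derivative a.T (at t))"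
    by (simp add: b.D_def pullback_nabla_def t(4) T[OF K(2)])
  then show ?D
    using metric_christoffel_transform[OF a.metric_chart_axioms b.metric_chart_axioms U(1) t(3) U(2) F iso,
        of "a.T t" "a.T t" w] t(3-5) F(2)
    by (simp add: b.metric_simps a.metric_simps a.D_def iso)
qed

section \<open>Legendre curves in a chart of a Sasakian space form\<close>

locale sasakian_legendre_curve = metric_curve \<Omega> G J x for \<Omega> :: "(real^3) set" and G J x +
  fixes \<eta> :: "real^3 \<Rightarrow> real^3 \<Rightarrow> real" and \<xi> :: "real^3 \<Rightarrow> real^3" and \<phi> :: "real^3 \<Rightarrow> real^3 \<Rightarrow> real^3"
    and k :: real
  assumes smooth_phi: "smooth_on \<Omega> (\<lambda>q. \<phi> q v)" and linear_phi: "q \<in> \<Omega> \<Longrightarrow> linear (\<phi> q)"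
    and smooth_xi: "smooth_on \<Omega> \<xi>"
    and eta_xi: "q \<in> \<Omega> \<Longrightarrow> \<eta> q (\<xi> q) = 1"
    and phi_phi: "q \<in> \<Omega> \<Longrightarrow> \<phi> q (\<phi> q u) = - u + \<eta> q u *\<^sub>R \<xi> q"
    and metric_phi: "q \<in> \<Omega> \<Longrightarrow> G q (\<phi> q u) (\<phi> q v) = G q u v - \<eta> q u * \<eta> q v"
    and metric_xi: "q \<in> \<Omega> \<Longrightarrow> G q (\<xi> q) u = \<eta> q u"
    and nabla_phi: "q \<in> \<Omega> \<Longrightarrow>
      nabla_endo G \<phi> (\<lambda>_. u) (\<lambda>_. v) q = G q u v *\<^sub>R \<xi> q - \<eta> q v *\<^sub>R u"
    and holomorphic: "q \<in> \<Omega> \<Longrightarrow> dim (span {u, v}) = 2 \<Longrightarrow> \<phi> q ` span {u, v} \<subseteq> span {u, v} \<Longrightarrow>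
      sectional_curvature G q u v = k"
    and unit_speed: "t \<in> J \<Longrightarrow> G (x t) (T t) (T t) = 1"
    and legendre: "t \<in> J \<Longrightarrow> \<eta> (x t) (T t) = 0"
begin

definition N :: "real \<Rightarrow> real^3" where
  "N t = \<phi> (x t) (T t)"

definition X :: "real \<Rightarrow> real^3" where
  "X t = \<xi> (x t)"

definition geodesic_curvature :: "real \<Rightarrow> real" where
  "geodesic_curvature t = G (x t) (D T t) (N t)"

text \<open>The squared length of \<phi>\<xi> is 1 - 1 = 0 by \<open>metric_phi\<close>.\<close>

lemma phi_xi: "q \<in> \<Omega> \<Longrightarrow> \<phi> q (\<xi> q) = 0"
  using metric_phi[of q "\<xi> q" "\<xi> q"] metric_xi[of q "\<xi> q"] eta_xi[of q] metric_pos[of q "\<phi> q (\<xi> q)"]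
  by fastforce

text \<open>Evaluate \<phi>\<phi>\<phi>u in two ways, applying \<open>phi_phi\<close> to u or to
  \<phi>u; the results differ by \<eta>(\<phi>u)\<xi>.\<close>

lemma eta_phi: "q \<in> \<Omega> \<Longrightarrow> \<eta> q (\<phi> q u) = 0"
proof -
  assume q: "q \<in> \<Omega>"
  have "\<phi> q (\<phi> q (\<phi> q u)) = - \<phi> q u"
    by (simp add: phi_phi[of q u] phi_xi linear_diff[OF linear_phi] linear_scale[OF linear_phi] q)
  then have "\<eta> q (\<phi> q u) *\<^sub>R \<xi> q = 0" using phi_phi[OF q, of "\<phi> q u"] by simp
  moreover have "\<xi> q \<noteq> 0" using metric_xi[OF q, of "\<xi> q"] eta_xi[OF q] by (auto simp: metric_simps q)
  ultimately show ?thesis by simp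
qed

text \<open>For the pair u, \<phi>u the law \<open>metric_phi\<close> equates g(u, \<phi>u) with its
  negative.\<close>

lemma metric_phi_same: "q \<in> \<Omega> \<Longrightarrow> G q u (\<phi> q u) = 0"
  using metric_phi[of q u "\<phi> q u"] metric_commute[of q u "\<phi> q u"] metric_commute[of q "\<xi> q" "\<phi> q u"]
    metric_xi[of q "\<phi> q u"]
  by (simp add: eta_phi phi_phi metric_simps)

lemma frame:
  assumes "t \<in> J"
  shows "G (x t) (T t) (N t) = 0" "G (x t) (N t) (T t) = 0" "G (x t) (N t) (N t) = 1"
    "G (x t) (X t) (T t) = 0" "G (x t) (T t) (X t) = 0" "G (x t) (X t) (N t) = 0"
    "G (x t) (N t) (X t) = 0" "G (x t) (X t) (X t) = 1" "G (x t) (T t) (T t) = 1"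
  using assms x_in[OF assms]
  by (simp_all add: N_def X_def metric_phi_same metric_xi metric_phi eta_phi eta_xi unit_speed legendre
      metric_commute[of "x t" _ "\<xi> (x t)"] metric_commute[of "x t" _ "T t"])

lemma smooth_N: "smooth_on J N"
  unfolding N_def[abs_def]
  by (rule smooth_on_family_apply[OF open_dom open_J x_in smooth_phi linear_phi smooth_x smooth_T])

lemma smooth_X: "smooth_on J X"
  unfolding X_def[abs_def] by (rule smooth_on_compose[OF open_dom open_J x_in smooth_xi smooth_x])

lemma smooth_geodesic_curvature: "smooth_on J geodesic_curvature"
  unfolding geodesic_curvature_def[abs_def] by (rule smooth_G[OF smooth_D[OF smooth_T] smooth_N])

text \<open>The frame is orthonormal for \<open>G\<close>, not for the standard inner product, so
  its independence is checked by hand. Three independent vectors span the space, and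
  \<open>v\<close> is then orthogonal to itself.\<close>

lemma orthogonal_frame_imp_zero:
  assumes t: "t \<in> J" and "G (x t) v (T t) = 0" "G (x t) v (N t) = 0" "G (x t) v (X t) = 0"
  shows "v = 0"
proof -
  note lin = linear_metric_right[OF x_in[OF t]] linear_metric_left[OF x_in[OF t]]
  note f = frame[OF t]
  have ne: "T t \<noteq> N t" "T t \<noteq> X t" "N t \<noteq> X t" "T t \<noteq> 0" using f by (auto simp: metric_simps x_in t)
  have "N t \<notin> span {T t}"
    using f by (auto simp: span_singleton metric_simps x_in t)
  moreover have "X t \<notin> span {N t, T t}"
    using f by (auto simp: span_insert span_singleton algebra_simps metric_simps x_in t)
  ultimately have "independent {X t, N t, T t}"
    using ne by (auto simp: independent_insert)
  moreover have "card {X t, N t, T t} = 3" using ne by auto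
  ultimately have "span {X t, N t, T t} = UNIV"
    using card_ge_dim_independent[of "{X t, N t, T t}" UNIV] by auto
  then have "v \<in> span {X t, N t, T t}" by simp
  then have "G (x t) v v = 0"
    using linear_eq_0_on_span[OF lin(1), of "{X t, N t, T t}" v v] assms by blast
  then show ?thesis using metric_pos[OF x_in[OF t], of v] by fastforce
qed

text \<open>The Sasaki identity for the constant fields with values \<open>T t\<close> and
  \<open>V t\<close> accounts for the terms without a derivative of \<open>V\<close>; the remaining
  term passes through \<phi> by linearity.\<close>

lemma D_phi:
  assumes V: "smooth_on J V" and t: "t \<in> J"
  shows "D (\<lambda>t. \<phi> (x t) (V t)) t =
      \<phi> (x t) (D V t) + G (x t) (T t) (V t) *\<^sub>R X t - \<eta> (x t) (V t) *\<^sub>R T t"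
proof -
  have "frechet_derivative (\<lambda>q. \<phi> q (V t)) (at (x t)) (T t) + \<Gamma> (x t) (T t) (\<phi> (x t) (V t))
      = \<phi> (x t) (\<Gamma> (x t) (T t) (V t)) + G (x t) (T t) (V t) *\<^sub>R X t - \<eta> (x t) (V t) *\<^sub>R T t"
    using nabla_phi[OF x_in[OF t], of "T t" "V t"]
    by (simp add: nabla_endo_def nabla_def frechet_derivative_const X_def algebra_simps)
  then show ?thesis
    using vector_derivative_family[of \<phi>, OF smooth_phi linear_phi V t]
    by (simp add: D_def linear_add[OF linear_phi] x_in t)
qed

text \<open>Differentiating \<phi>\<xi> = 0 along the curve gives \<phi>(D\<xi>) = T, and
  differentiating g(\<xi>,\<xi>) = 1 gives \<eta>(D\<xi>) = 0. A second application of \<phi>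
  recovers D\<xi>.\<close>

lemma D_X:
  assumes t: "t \<in> J"
  shows "D X t = - N t"
proof -
  have "vector_derivative (\<lambda>s. \<phi> (x s) (X s)) (at t) = vector_derivative (\<lambda>_. 0) (at t)"
    by (rule vector_derivative_cong[OF _ t]) (simp add: X_def phi_xi x_in)
  then have "D (\<lambda>s. \<phi> (x s) (X s)) t = 0"
    using t by (simp add: D_def X_def phi_xi x_in christoffel_simps)
  then have phi: "\<phi> (x t) (D X t) = T t"
    using D_phi[OF smooth_X t] frame[OF t] t by (simp add: X_def eta_xi x_in)
  have "vector_derivative (\<lambda>s. G (x s) (X s) (X s)) (at t) = vector_derivative (\<lambda>_. 1) (at t)"
    by (rule vector_derivative_cong[OF _ t]) (simp add: frame)
  then have "\<eta> (x t) (D X t) = 0"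
    using vector_derivative_G[OF smooth_X smooth_X t] metric_commute[OF x_in[OF t], of "D X t"]
    by (simp add: X_def metric_xi x_in t)
  then show ?thesis
    using phi_phi[OF x_in[OF t], of "D X t"] phi by (simp add: N_def)
qed

text \<open>Unit speed removes the component along T. The Legendre condition removes the one along
  \<xi>, because the derivative of \<xi> is -N and thus orthogonal to T.\<close>

lemma D_T:
  assumes t: "t \<in> J"
  shows "D T t = geodesic_curvature t *\<^sub>R N t"
proof -
  have "vector_derivative (\<lambda>s. G (x s) (T s) (T s)) (at t) = vector_derivative (\<lambda>_. 1) (at t)"
    by (rule vector_derivative_cong[OF _ t]) (simp add: frame)
  then have 1: "G (x t) (D T t) (T t) = 0"
    using vector_derivative_G[OF smooth_T smooth_T t] metric_commute[OF x_in[OF t], of "D T t"]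
    by simp
  have "vector_derivative (\<lambda>s. G (x s) (T s) (X s)) (at t) = vector_derivative (\<lambda>_. 0) (at t)"
    by (rule vector_derivative_cong[OF _ t]) (simp add: frame)
  then have 2: "G (x t) (D T t) (X t) = 0"
    using vector_derivative_G[OF smooth_T smooth_X t] frame[OF t]
    by (simp add: D_X t metric_simps x_in)
  have "D T t - geodesic_curvature t *\<^sub>R N t = 0"
    by (rule orthogonal_frame_imp_zero[OF t])
       (use 1 2 frame[OF t] in \<open>simp_all add: metric_simps x_in t geodesic_curvature_def\<close>)
  then show ?thesis by simp
qed

text \<open>The coefficient of \<xi> is g(T,T) = 1, contributed by the Sasaki identity; it is the
  source of the constant torsion.\<close>

lemma D_N:
  assumes t: "t \<in> J"
  shows "D N t = X t - geodesic_curvature t *\<^sub>R T t"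
proof -
  have "D N t = \<phi> (x t) (D T t) + X t"
    using D_phi[OF smooth_T t] t by (simp add: N_def[abs_def] unit_speed legendre)
  then show ?thesis
    by (simp add: D_T t linear_scale[OF linear_phi] x_in N_def phi_phi legendre)
qed

text \<open>The plane of T and N is \<phi>-invariant since \<phi>N = -T, and orthonormality makes
  the denominator of its sectional curvature 1.\<close>

lemma metric_curvature_N_T:
  assumes t: "t \<in> J"
  shows "G (x t) (curvature_at G (x t) (N t) (T t) (T t)) (N t) = k"
proof -
  have "N t \<noteq> T t" "T t \<noteq> 0" "N t \<notin> span {T t}"
    using frame[OF t] by (auto simp: span_singleton metric_simps x_in t)
  then have "independent {N t, T t}" "card {N t, T t} = 2" by (auto simp: independent_insert)
  then have "dim (span {N t, T t}) = 2" by (simp add: dim_eq_card_independent)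
  moreover have "\<phi> (x t) ` span {N t, T t} \<subseteq> span {N t, T t}"
  proof -
    have "\<phi> (x t) (N t) = - T t" using t by (simp add: N_def phi_phi x_in legendre)
    then have "\<phi> (x t) ` {N t, T t} \<subseteq> span {N t, T t}"
      by (auto simp: N_def[symmetric] span_base span_neg)
    then show ?thesis
      by (metis linear_phi linear_span_image span_mono span_span t x_in)
  qed
  ultimately have "sectional_curvature G (x t) (N t) (T t) = k"
    by (rule holomorphic[OF x_in[OF t]])
  then show ?thesis using frame[OF t] by (simp add: sectional_curvature_def)
qed

abbreviation "d \<equiv> \<lambda>f t. vector_derivative f (at t)"

text \<open>The coefficient of T is -\<kappa>\<kappa>' from the derivative of N plus
  -2\<kappa>\<kappa>' from that of -\<kappa>^2. The coefficient of N is \<kappa>'' minus \<kappa>^3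
  from the derivative of T and minus \<kappa> from that of \<xi>. The curvature term adds 0 to the
  former and k\<kappa> to the latter.\<close>

lemma bitension_components:
  assumes bih: "D (D (D T)) t + curvature_at G (x t) (D T t) (T t) (T t) = 0" and t: "t \<in> J"
  shows "geodesic_curvature t * d geodesic_curvature t = 0"
    and "d (d geodesic_curvature) t = geodesic_curvature t ^ 3 + geodesic_curvature t - k * geodesic_curvature t"
proof -
  let ?k = geodesic_curvature
  note sm = smooth_geodesic_curvature smooth_on_vector_derivative[OF open_J smooth_geodesic_curvature]
    smooth_on_mult[OF open_J] smooth_on_scaleR[OF open_J] smooth_on_const[OF open_J] smooth_on_add[OF open_J]
    smooth_T smooth_N smooth_X
  have 2: "D (D T) s = d ?k s *\<^sub>R N s + (((-1) * (?k s * ?k s)) *\<^sub>R T s + ?k s *\<^sub>R X s)" if s: "s \<in> J" for s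
    using D_cong[of "D T" "\<lambda>s. ?k s *\<^sub>R N s", OF D_T s]
    by (simp add: D_scaleR sm s D_N scaleR_diff_right)
  have kk: "d (\<lambda>s. (-1) * (?k s * ?k s)) t = - 2 * ?k t * d ?k t"
    using vector_derivative_at[OF has_vector_derivative_mult_right[OF has_vector_derivative_mult[OF
      smooth_on_has_vector_derivative[OF sm(1) t] smooth_on_has_vector_derivative[OF sm(1) t]]], of "-1"]
    by (simp add: algebra_simps)
  have "D (D (D T)) t = D (\<lambda>s. d ?k s *\<^sub>R N s + (((-1) * (?k s * ?k s)) *\<^sub>R T s + ?k s *\<^sub>R X s)) t"
    by (rule D_cong[OF 2 t])
  also have "\<dots> = (d (d ?k) t *\<^sub>R N t + d ?k t *\<^sub>R D N t)
      + ((d (\<lambda>s. (-1) * (?k s * ?k s)) t *\<^sub>R T t + ((-1) * (?k t * ?k t)) *\<^sub>R D T t)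
      + (d ?k t *\<^sub>R X t + ?k t *\<^sub>R D X t))"
    by (simp only: D_add D_scaleR sm t)
  finally have *: "(d (d ?k) t *\<^sub>R N t + d ?k t *\<^sub>R (X t - ?k t *\<^sub>R T t))
      + (((- 2 * ?k t * d ?k t) *\<^sub>R T t + ((-1) * (?k t * ?k t)) *\<^sub>R (?k t *\<^sub>R N t))
      + (d ?k t *\<^sub>R X t + ?k t *\<^sub>R (- N t)))
      + ?k t *\<^sub>R curvature_at G (x t) (N t) (T t) (T t) = 0" (is "?v = 0")
    using bih by (simp only: kk D_T D_N D_X t curvature_at_scaleR x_in)
  have "G (x t) ?v (T t) = 0" "G (x t) ?v (N t) = 0"
    unfolding * by (simp_all add: metric_simps x_in t)
  then show "?k t * d ?k t = 0" and "d (d ?k) t = ?k t ^ 3 + ?k t - k * ?k t"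
    by (simp_all only: metric_simps x_in t metric_curvature_at_same metric_curvature_N_T frame power3_eq_cube)
       (simp_all add: algebra_simps)
qed

end

section \<open>Polyharmonic Legendre curves\<close>

locale polyharmonic_legendre_curve =
  fixes A :: "('m::{t2_space,second_countable_topology}, real^3) chart set"
    and \<eta> :: "('m, real^3) chart \<Rightarrow> real^3 \<Rightarrow> real^3 \<Rightarrow> real"
    and \<xi> :: "('m, real^3) chart \<Rightarrow> real^3 \<Rightarrow> real^3"
    and \<phi> :: "('m, real^3) chart \<Rightarrow> real^3 \<Rightarrow> real^3 \<Rightarrow> real^3"
    and g :: "('m, real^3) chart \<Rightarrow> real^3 \<Rightarrow> real^3 \<Rightarrow> real^3 \<Rightarrow> real"
    and k :: real
    and I :: "real set"
    and \<gamma> :: "real \<Rightarrow> 'm"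
  assumes space_form: "sasakian_space_form A \<eta> \<xi> \<phi> g k"
    and interval: "open_interval I"
    and legendre: "legendre_curve A \<eta> g I \<gamma>"
    and polyharmonic: "polyharmonic_curve A g I \<gamma>"
begin

abbreviation param :: "('m, real^3) chart \<Rightarrow> real set" where "param \<equiv> curve_dom I \<gamma>"
abbreviation loc :: "('m, real^3) chart \<Rightarrow> real \<Rightarrow> real^3" where "loc a \<equiv> (\<lambda>t. snd a (\<gamma> t))"

definition normal :: "('m, real^3) chart \<Rightarrow> real \<Rightarrow> real^3" where
  "normal a = sasakian_legendre_curve.N (loc a) (\<phi> a)"

definition reeb :: "('m, real^3) chart \<Rightarrow> real \<Rightarrow> real^3" where
  "reeb a = sasakian_legendre_curve.X (loc a) (\<xi> a)"

definition signed_curvature :: "('m, real^3) chart \<Rightarrow> real \<Rightarrow> real" where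
  "signed_curvature a = sasakian_legendre_curve.geodesic_curvature (g a) (loc a) (\<phi> a)"

lemma contact: "contact_riemannian A \<eta> \<xi> \<phi> g" and sasaki: "sasaki A \<eta> \<xi> \<phi> g"
  and atlas: "smooth_atlas A"
  using space_form by (auto simp: sasakian_space_form_def sasaki_def contact_riemannian_def)

lemma curve: "unit_speed_curve A g I \<gamma>" "smooth_curve A I \<gamma>"
  using legendre by (auto simp: legendre_curve_def unit_speed_curve_def)

lemma open_param: "a \<in> A \<Longrightarrow> open (param a)"
proof -
  assume a: "a \<in> A"
  have "continuous_on I \<gamma>" "open I" "open (fst a)"
    using curve interval atlas a by (auto simp: smooth_curve_def open_interval_def smooth_atlas_def)
  then have "open (I \<inter> \<gamma> -` fst a)" by (intro continuous_open_preimage)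
  moreover have "I \<inter> \<gamma> -` fst a = param a" by (auto simp: curve_dom_def)
  ultimately show ?thesis by simp
qed

lemma metric_curve_chart:
  assumes a: "a \<in> A"
  shows "metric_curve (coord_dom a) (g a) (param a) (loc a)"
proof
  show "open (coord_dom a)" using atlas a by (auto simp: smooth_atlas_def)
  show "metric_on (coord_dom a) (g a)"
    using contact a by (auto simp: contact_riemannian_def riemannian_metric_def)
  show "open (param a)" by (rule open_param[OF a])
  show "smooth_on (param a) (loc a)" using curve(2) a by (auto simp: smooth_curve_def)
  show "loc a t \<in> coord_dom a" if "t \<in> param a" for t
    using that by (auto simp: curve_dom_def coord_dom_def)
qed

lemma velocity_eq: "a \<in> A \<Longrightarrow> velocity \<gamma> a = metric_curve.T (loc a)"
  by (rule ext) (simp add: velocity_def metric_curve.T_def[OF metric_curve_chart])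

lemma cov_along_eq: "a \<in> A \<Longrightarrow> cov_along g \<gamma> V a = metric_curve.D (g a) (loc a) (V a)"
  by (rule ext) (simp add: cov_along_def velocity_eq metric_curve.D_def[OF metric_curve_chart])

lemma legendre_curve_chart:
  assumes a: "a \<in> A"
  shows "sasakian_legendre_curve (coord_dom a) (g a) (param a) (loc a) (\<eta> a) (\<xi> a) (\<phi> a) k"
proof -
  interpret metric_curve "coord_dom a" "g a" "param a" "loc a" by (rule metric_curve_chart[OF a])
  note c = contact[unfolded contact_riemannian_def]
  show ?thesis
  proof (rule sasakian_legendre_curve.intro[OF metric_curve_axioms sasakian_legendre_curve_axioms.intro])
    show "smooth_on (coord_dom a) (\<lambda>q. \<phi> a q v)" for v
      using c a by (auto simp: endomorphism_field_def)
    show "smooth_on (coord_dom a) (\<xi> a)" using c a by (auto simp: vector_field_def vfields_def)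
    show "linear (\<phi> a q)" if "q \<in> coord_dom a" for q
      using c a that by (auto simp: endomorphism_field_def)
    show "\<eta> a q (\<xi> a q) = 1" if "q \<in> coord_dom a" for q
      using c a that by auto
    show "\<phi> a q (\<phi> a q u) = - u + \<eta> a q u *\<^sub>R \<xi> a q" if "q \<in> coord_dom a" for q u
      using c a that by auto
    show "g a q (\<phi> a q u) (\<phi> a q v) = g a q u v - \<eta> a q u * \<eta> a q v"
      if "q \<in> coord_dom a" for q u v
      using c a that by auto
    show "g a q (\<xi> a q) u = \<eta> a q u" if "q \<in> coord_dom a" for q u
      using c a that by auto
    have "(\<lambda>_. u) \<in> vfields (coord_dom a)" for u :: "real^3"
      using smooth_on_const[OF open_dom] by (simp add: vfields_def)
    then show "nabla_endo (g a) (\<phi> a) (\<lambda>_. u) (\<lambda>_. v) q = g a q u v *\<^sub>R \<xi> a q - \<eta> a q v *\<^sub>R u"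
      if "q \<in> coord_dom a" for q u v
      using sasaki a that unfolding sasaki_def by blast
    show "sectional_curvature (g a) q u v = k"
      if "q \<in> coord_dom a" "dim (span {u, v}) = 2" "\<phi> a q ` span {u, v} \<subseteq> span {u, v}" for q u v
      using space_form a that unfolding sasakian_space_form_def constant_holomorphic_curvature_def by blast
    show "g a (loc a t) (T t) (T t) = 1" if "t \<in> param a" for t
      using curve(1) a that velocity_eq[OF a] by (auto simp: unit_speed_curve_def)
    show "\<eta> a (loc a t) (T t) = 0" if "t \<in> param a" for t
      using legendre a that velocity_eq[OF a] by (auto simp: legendre_curve_def)
  qed
qed

lemma
  assumes a: "a \<in> A"
  shows smooth_normal: "smooth_on (param a) (normal a)"
    and smooth_reeb: "smooth_on (param a) (reeb a)"
    and smooth_signed_curvature: "smooth_on (param a) (signed_curvature a)"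
    and normal_eq: "normal a t = \<phi> a (loc a t) (velocity \<gamma> a t)"
    and reeb_eq: "reeb a t = \<xi> a (loc a t)"
    and signed_curvature_eq: "signed_curvature a t =
      g a (loc a t) (cov_along g \<gamma> (velocity \<gamma>) a t) (\<phi> a (loc a t) (velocity \<gamma> a t))"
proof -
  interpret sasakian_legendre_curve "coord_dom a" "g a" "param a" "loc a" "\<eta> a" "\<xi> a" "\<phi> a" k
    by (rule legendre_curve_chart[OF a])
  show "smooth_on (param a) (normal a)" "smooth_on (param a) (reeb a)"
    "smooth_on (param a) (signed_curvature a)"
    by (simp_all add: normal_def reeb_def signed_curvature_def smooth_N smooth_X smooth_geodesic_curvature)
  show "normal a t = \<phi> a (loc a t) (velocity \<gamma> a t)" "reeb a t = \<xi> a (loc a t)"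
    "signed_curvature a t =
      g a (loc a t) (cov_along g \<gamma> (velocity \<gamma>) a t) (\<phi> a (loc a t) (velocity \<gamma> a t))"
    by (simp_all add: normal_def reeb_def signed_curvature_def N_def X_def geodesic_curvature_def
        velocity_eq cov_along_eq a)
qed

text \<open>The constant factor \<open>s\<close> prepares for the sign that turns this frame into a
  Frenet frame with nonnegative curvature.\<close>

lemma frame_chart:
  assumes a: "a \<in> A" and t: "t \<in> param a"
  shows "g a (loc a t) (normal a t) (normal a t) = 1"
    and "g a (loc a t) (reeb a t) (reeb a t) = 1"
    and "g a (loc a t) (velocity \<gamma> a t) (normal a t) = 0"
    and "g a (loc a t) (velocity \<gamma> a t) (reeb a t) = 0"
    and "g a (loc a t) (normal a t) (reeb a t) = 0"
    and "cov_along g \<gamma> (velocity \<gamma>) a t = signed_curvature a t *\<^sub>R normal a t"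
    and "cov_along g \<gamma> (\<lambda>a t. s *\<^sub>R normal a t) a t =
      s *\<^sub>R (reeb a t - signed_curvature a t *\<^sub>R velocity \<gamma> a t)"
    and "cov_along g \<gamma> (\<lambda>a t. s *\<^sub>R reeb a t) a t = - s *\<^sub>R normal a t"
proof -
  interpret sasakian_legendre_curve "coord_dom a" "g a" "param a" "loc a" "\<eta> a" "\<xi> a" "\<phi> a" k
    by (rule legendre_curve_chart[OF a])
  note sc = D_scaleR[OF smooth_on_const[OF open_J, of s] smooth_N t]
    D_scaleR[OF smooth_on_const[OF open_J, of s] smooth_X t]
  show "g a (loc a t) (normal a t) (normal a t) = 1" "g a (loc a t) (reeb a t) (reeb a t) = 1"
    "g a (loc a t) (velocity \<gamma> a t) (normal a t) = 0" "g a (loc a t) (velocity \<gamma> a t) (reeb a t) = 0"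
    "g a (loc a t) (normal a t) (reeb a t) = 0"
    "cov_along g \<gamma> (velocity \<gamma>) a t = signed_curvature a t *\<^sub>R normal a t"
    "cov_along g \<gamma> (\<lambda>a t. s *\<^sub>R normal a t) a t =
      s *\<^sub>R (reeb a t - signed_curvature a t *\<^sub>R velocity \<gamma> a t)"
    "cov_along g \<gamma> (\<lambda>a t. s *\<^sub>R reeb a t) a t = - s *\<^sub>R normal a t"
    by (simp_all add: velocity_eq cov_along_eq a normal_def reeb_def signed_curvature_def frame D_T D_N D_X t
        sc)
qed

lemma signed_curvature_equations:
  fixes a
  defines "\<kappa> \<equiv> signed_curvature a"
  assumes a: "a \<in> A" and t: "t \<in> param a"
  shows "\<kappa> t * vector_derivative \<kappa> (at t) = 0"
    and "vector_derivative (\<lambda>t. vector_derivative \<kappa> (at t)) (at t) = \<kappa> t ^ 3 + \<kappa> t - k * \<kappa> t"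
proof -
  interpret sasakian_legendre_curve "coord_dom a" "g a" "param a" "loc a" "\<eta> a" "\<xi> a" "\<phi> a" k
    by (rule legendre_curve_chart[OF a])
  have "bitension g \<gamma> a t = 0" using polyharmonic a t by (auto simp: polyharmonic_curve_def)
  then have "D (D (D T)) t + curvature_at (g a) (loc a t) (D T t) (T t) (T t) = 0"
    by (simp add: bitension_def jacobi_operator_def rough_laplacian_def tension_def cov_along_eq velocity_eq a
        add.commute)
  from bitension_components[OF this t]
  show "\<kappa> t * vector_derivative \<kappa> (at t) = 0"
    and "vector_derivative (\<lambda>t. vector_derivative \<kappa> (at t)) (at t) = \<kappa> t ^ 3 + \<kappa> t - k * \<kappa> t"
    by (simp_all add: \<kappa>_def signed_curvature_def)
qed

text \<open>As \<phi> is a tensor, the normal transforms like the velocity. The law for the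
  derivative of the velocity, tested on the normal, then gives equality of the signed
  curvatures.\<close>

lemma transition_along:
  assumes a: "a \<in> A" and b: "b \<in> A" and t: "t \<in> param a" "t \<in> param b"
  shows "open (overlap a b)" and "overlap a b \<subseteq> coord_dom a" and "loc a t \<in> overlap a b"
    and "loc b t = transition a b (loc a t)"
    and "linear (jacobian a b (loc a t))"
    and "velocity \<gamma> b t = jacobian a b (loc a t) (velocity \<gamma> a t)"
    and "normal b t = jacobian a b (loc a t) (normal a t)"
    and "reeb b t = jacobian a b (loc a t) (reeb a t)"
    and "signed_curvature a t = signed_curvature b t"
proof -
  have hom: "homeomorphism (fst a) (coord_dom a) (snd a) (chart_inv a)" and op: "open (coord_dom a)" "open (fst b)"
    using atlas a b by (auto simp: smooth_atlas_def)
  have "overlap a b = coord_dom a \<inter> chart_inv a -` fst b"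
    using hom by (auto simp: overlap_def coord_dom_def homeomorphism_def image_iff)
  then show opov: "open (overlap a b)"
    using continuous_open_preimage[OF homeomorphism_cont2[OF hom] op] by simp
  show sub: "overlap a b \<subseteq> coord_dom a" by (auto simp: overlap_def coord_dom_def)
  have loc: "loc a s \<in> overlap a b \<and> loc b s = transition a b (loc a s)" if "s \<in> param a \<inter> param b" for s
    using that homeomorphism_apply1[OF hom] by (auto simp: overlap_def transition_def curve_dom_def)
  show q: "loc a t \<in> overlap a b" and tr: "loc b t = transition a b (loc a t)" using loc t by auto
  have sm: "smooth_on (overlap a b) (transition a b)"
    using atlas a b by (auto simp: smooth_atlas_def)
  show "linear (jacobian a b (loc a t))"
    by (rule has_derivative_linear[OF smooth_on_has_derivative[OF sm q]])
  have tensors: "\<phi> b (transition a b p) (jacobian a b p v) = jacobian a b p (\<phi> a p v)"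
    "\<xi> b (transition a b p) = jacobian a b p (\<xi> a p)"
    "g b (transition a b p) (jacobian a b p u) (jacobian a b p v) = g a p u v"
    if "p \<in> overlap a b" for p u v
    using contact a b that
    by (auto simp: contact_riemannian_def endomorphism_field_def vector_field_def riemannian_metric_def)
  have into: "transition a b p \<in> coord_dom b" if "p \<in> overlap a b" for p
    using that homeomorphism_apply1[OF hom] by (auto simp: overlap_def transition_def coord_dom_def)
  note D_T = metric_D_T_transform[OF metric_curve_chart[OF a] metric_curve_chart[OF b] opov sub sm into tensors(3)
      open_Int[OF open_param[OF a] open_param[OF b]] _ Int_lower1 Int_lower2 loc, of t]
  show vel: "velocity \<gamma> b t = jacobian a b (loc a t) (velocity \<gamma> a t)"
    using D_T(1) t by (simp add: velocity_eq a b)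
  then show n: "normal b t = jacobian a b (loc a t) (normal a t)"
    by (simp add: normal_eq a b tr tensors(1)[OF q])
  show "reeb b t = jacobian a b (loc a t) (reeb a t)"
    by (simp add: reeb_eq a b tr tensors(2)[OF q])
  show "signed_curvature a t = signed_curvature b t"
    using D_T(2)[of "normal a t"] n t
    by (simp add: signed_curvature_eq normal_eq cov_along_eq velocity_eq a b)
qed

text \<open>For a parameter in \<open>I\<close> the chosen chart does not affect the value, by the
  last claim of \<open>transition_along\<close>; outside \<open>I\<close> the value is
  unspecified.\<close>

definition curvature_function :: "real \<Rightarrow> real" where
  "curvature_function t = signed_curvature (SOME a. a \<in> A \<and> t \<in> param a) t"

lemma covering: "t \<in> I \<Longrightarrow> \<exists>a\<in>A. t \<in> param a"
  using atlas by (fastforce simp: smooth_atlas_def curve_dom_def)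

lemma curvature_function_eq:
  assumes "a \<in> A" "t \<in> param a"
  shows "curvature_function t = signed_curvature a t"
  unfolding curvature_function_def
  using transition_along(9)[of "SOME a. a \<in> A \<and> t \<in> param a" a t]
    someI[of "\<lambda>a. a \<in> A \<and> t \<in> param a", OF conjI[OF assms]] assms by blast

lemma curvature_function_has_derivative:
  assumes a: "a \<in> A" and t: "t \<in> param a"
  shows "(curvature_function has_real_derivative vector_derivative (signed_curvature a) (at t)) (at t)"
  unfolding has_real_derivative_iff_has_vector_derivative
  by (rule has_vector_derivative_transform_within_open[OF
        smooth_on_has_vector_derivative[OF smooth_signed_curvature[OF a] t] open_param[OF a] t])
     (simp add: curvature_function_eq[OF a])

text \<open>The square of \<kappa> has derivative 2\<kappa>\<kappa>' = 0 and is constant on the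
  interval. If it is not 0, then \<kappa>' = 0 everywhere, and the second equation becomes
  \<kappa>(\<kappa>^2 - (k - 1)) = 0.\<close>

lemma curvature_function_const:
  obtains r where "\<And>t. t \<in> I \<Longrightarrow> curvature_function t = r" and "r = 0 \<or> r\<^sup>2 = k - 1"
proof -
  have I: "convex I" "I \<noteq> {}" "open I"
    using interval by (auto simp: open_interval_def is_interval_convex)
  have const: "\<exists>r. \<forall>t\<in>I. f t = r" if "\<And>t. t \<in> I \<Longrightarrow> (f has_real_derivative 0) (at t)" for f
    using has_field_derivative_zero_constant[OF I(1), of f] that
    by (meson has_field_derivative_at_within)
  have ex: "\<exists>d. (curvature_function has_real_derivative d) (at t) \<and> curvature_function t * d = 0" if "t \<in> I" for t
    using covering[OF that] curvature_function_has_derivative signed_curvature_equations(1) curvature_function_eq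
    by metis
  have "((\<lambda>t. (curvature_function t)\<^sup>2) has_real_derivative 0) (at t)" if t: "t \<in> I" for t
  proof -
    obtain d where "(curvature_function has_real_derivative d) (at t)" "curvature_function t * d = 0"
      using ex t by blast
    then show ?thesis by (auto intro!: derivative_eq_intros)
  qed
  from const[OF this] obtain s where s: "\<And>t. t \<in> I \<Longrightarrow> (curvature_function t)\<^sup>2 = s" by blast
  show ?thesis
  proof (cases "s = 0")
    case True
    then show ?thesis using s that[of 0] by simp
  next
    case False
    have "(curvature_function has_real_derivative 0) (at t)" if "t \<in> I" for t
      using ex[OF that] s[OF that] False by (metis mult_eq_0_iff zero_eq_power2)
    from const[OF this] obtain r where r: "\<And>t. t \<in> I \<Longrightarrow> curvature_function t = r" by blast
    obtain t a where t: "t \<in> I" "a \<in> A" "t \<in> param a" using I(2) covering by blast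
    interpret metric_curve "coord_dom a" "g a" "param a" "loc a" by (rule metric_curve_chart[OF t(2)])
    have \<kappa>: "signed_curvature a u = r" if "u \<in> param a" for u
      using curvature_function_eq[OF t(2) that] r[of u] that by (simp add: curve_dom_def)
    \<comment> \<open>The first derivative has to vanish on an open set of parameters, not just at
      \<open>t\<close>, for the second one to vanish at \<open>t\<close>.\<close>
    have "vector_derivative (signed_curvature a) (at u) = 0" if "u \<in> param a" for u
      using vector_derivative_cong[of "signed_curvature a" "\<lambda>_. r", OF \<kappa> that] by simp
    then have "vector_derivative (\<lambda>u. vector_derivative (signed_curvature a) (at u)) (at t) = 0"
      using vector_derivative_cong[of "\<lambda>u. vector_derivative (signed_curvature a) (at u)" "\<lambda>_. 0", OF _ t(3)] by simp
    then have "r * (r\<^sup>2 - (k - 1)) = 0"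
      using signed_curvature_equations(2)[OF t(2,3)]
      by (simp add: \<kappa> t algebra_simps power2_eq_square power3_eq_cube)
    moreover have "r \<noteq> 0" using s[OF t(1)] r[OF t(1)] False by auto
    ultimately show ?thesis using r that by simp
  qed
qed

section \<open>Geodesics and helices from constant signed curvature\<close>

lemma geodesic_if_curvature_zero:
  assumes "\<And>t. t \<in> I \<Longrightarrow> curvature_function t = 0"
  shows "legendre_geodesic A \<eta> g I \<gamma>"
proof -
  have "cov_along g \<gamma> (velocity \<gamma>) a t = 0" if "a \<in> A" "t \<in> param a" for a t
    using frame_chart(6)[OF that] curvature_function_eq[OF that] assms[of t] that by (simp add: curve_dom_def)
  then show ?thesis using legendre curve by (simp add: legendre_geodesic_def geodesic_def)
qed

text \<open>The Frenet frame is \<open>(\<gamma>', \<sigma> \<phi>\<gamma>', \<sigma> \<xi>)\<close>, where \<open>\<sigma>\<close> is the sign of the signed curvature; its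
  torsion is \<open>1\<close>.\<close>

lemma helix_if_curvature_const:
  assumes r: "\<And>t. t \<in> I \<Longrightarrow> curvature_function t = r" and "r \<noteq> 0"
  shows "legendre_helix_of_curvature A \<eta> g I \<gamma> \<bar>r\<bar>"
proof -
  define s where "s = sgn r"
  have s: "s * s = 1" "\<bar>r\<bar> * s = r" "s * r = \<bar>r\<bar>"
    using \<open>r \<noteq> 0\<close> by (auto simp: s_def sgn_if)
  have \<kappa>: "signed_curvature a t = r" if "a \<in> A" "t \<in> param a" for a t
    using curvature_function_eq[OF that] r[of t] that by (simp add: curve_dom_def)
  have along: "vector_field_along A I \<gamma> (\<lambda>a t. s *\<^sub>R V a t)"
    if "\<And>a. a \<in> A \<Longrightarrow> smooth_on (param a) (V a)"
      and "\<And>a b t. a \<in> A \<Longrightarrow> b \<in> A \<Longrightarrow> t \<in> param a \<Longrightarrow> t \<in> param b \<Longrightarrow>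
        V b t = jacobian a b (loc a t) (V a t)" for V
    unfolding vector_field_along_def
  proof (intro conjI ballI)
    show "smooth_on (param a) (\<lambda>t. s *\<^sub>R V a t)" if "a \<in> A" for a
      using that \<open>a \<in> A \<Longrightarrow> smooth_on (param a) (V a)\<close>
      by (intro smooth_on_scaleR smooth_on_const open_param)
    fix a b t assume ab: "a \<in> A" "b \<in> A" and "t \<in> param a \<inter> param b"
    then show "s *\<^sub>R V b t = jacobian a b (loc a t) (s *\<^sub>R V a t)"
      using linear_scale[OF transition_along(5)[OF ab]] that(2)[OF ab] by simp
  qed
  have "frenet_curve A g I \<gamma> (\<lambda>a t. s *\<^sub>R normal a t) (\<lambda>a t. s *\<^sub>R reeb a t) (\<lambda>_. \<bar>r\<bar>) (\<lambda>_. 1)"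
    unfolding frenet_curve_def Let_def
  proof (intro conjI ballI curve along smooth_normal smooth_reeb transition_along(7,8))
    fix a t assume a: "a \<in> A" and t: "t \<in> param a"
    interpret metric_curve "coord_dom a" "g a" "param a" "loc a" by (rule metric_curve_chart[OF a])
    note f = frame_chart[OF a t] \<kappa>[OF a t] x_in[OF t]
    show "g a (loc a t) (s *\<^sub>R normal a t) (s *\<^sub>R normal a t) = 1"
      "g a (loc a t) (s *\<^sub>R reeb a t) (s *\<^sub>R reeb a t) = 1"
      "g a (loc a t) (velocity \<gamma> a t) (s *\<^sub>R normal a t) = 0"
      "g a (loc a t) (velocity \<gamma> a t) (s *\<^sub>R reeb a t) = 0"
      "g a (loc a t) (s *\<^sub>R normal a t) (s *\<^sub>R reeb a t) = 0"
      by (simp_all add: metric_simps f s)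
    show "cov_along g \<gamma> (velocity \<gamma>) a t = \<bar>r\<bar> *\<^sub>R s *\<^sub>R normal a t"
      by (simp add: f s)
    show "cov_along g \<gamma> (\<lambda>a t. s *\<^sub>R normal a t) a t = - \<bar>r\<bar> *\<^sub>R velocity \<gamma> a t + 1 *\<^sub>R s *\<^sub>R reeb a t"
      by (simp add: f s scaleR_diff_right)
    show "cov_along g \<gamma> (\<lambda>a t. s *\<^sub>R reeb a t) a t = - 1 *\<^sub>R s *\<^sub>R normal a t"
      by (simp add: f)
  qed auto
  then show ?thesis
    using legendre unfolding legendre_helix_of_curvature_def helix_of_curvature_def by fast
qed

end

theorem theorem3p3:
  fixes A :: "('m::{t2_space,second_countable_topology}, real^3) chart set"
    and \<eta> :: "('m, real^3) chart \<Rightarrow> real^3 \<Rightarrow> real^3 \<Rightarrow> real"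
    and \<xi> :: "('m, real^3) chart \<Rightarrow> real^3 \<Rightarrow> real^3"
    and \<phi> :: "('m, real^3) chart \<Rightarrow> real^3 \<Rightarrow> real^3 \<Rightarrow> real^3"
    and g :: "('m, real^3) chart \<Rightarrow> real^3 \<Rightarrow> real^3 \<Rightarrow> real^3 \<Rightarrow> real"
    and c :: real
    and I :: "real set"
    and \<gamma> :: "real \<Rightarrow> 'm"
  assumes "sasakian_space_form A \<eta> \<xi> \<phi> g c"
    and "open_interval I"
    and "legendre_curve A \<eta> g I \<gamma>"
    and "polyharmonic_curve A g I \<gamma>"
  shows "(c \<le> 1 \<longrightarrow> legendre_geodesic A \<eta> g I \<gamma>) \<and>
         (c > 1 \<longrightarrow> legendre_geodesic A \<eta> g I \<gamma> \<or>
                     legendre_helix_of_curvature A \<eta> g I \<gamma> (sqrt (c - 1)))"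
proof -
  interpret polyharmonic_legendre_curve A \<eta> \<xi> \<phi> g c I \<gamma>
    by unfold_locales (fact assms)+
  obtain r where r: "\<And>t. t \<in> I \<Longrightarrow> curvature_function t = r" "r = 0 \<or> r\<^sup>2 = c - 1"
    using curvature_function_const by blast
  show ?thesis
  proof (cases "r = 0")
    case True
    then show ?thesis using geodesic_if_curvature_zero r(1) by simp
  next
    case False
    then have r2: "r\<^sup>2 = c - 1" using r(2) by blast
    \<comment> \<open>A nonzero curvature forces c > 1, which settles the case c \<le> 1.\<close>
    have "0 < r\<^sup>2" using False by simp
    then have "1 < c" using r2 by linarith
    moreover have "sqrt (c - 1) = \<bar>r\<bar>" using r2 by (metis real_sqrt_abs)
    ultimately show ?thesis using helix_if_curvature_const[OF r(1) False] by auto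
  qed
qed

end
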